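(* Let $n,k\in\mathbb{N}$. Then an $(n-k)$-regular bipartite false twin-free graph $G$ on $2n$ vertices with $\gamma_t(G)=\gamma_{gr}^t(G)=6$ exists if and only if $n=k^2-k+1$ and there exists a finite projective plane of order $k-1$ (equivalently an affine plane of order $k-1$, or $k-2$ MOLS$(k-1)$, or an orthogonal array $OA(k,k-1)$).
   Context: Graph notions: For a vertex $v$ of a graph $G$, $N(v)$ denotes the open neighborhood (set of all neighbors) of $v$. Two distinct vertices $u,v$ are false twins if $N(u)=N(v)$; a graph is false twin-free if it has no false twins. Let $G$ be a graph without isolated vertices. A set $S\subseteq V(G)$ is a total dominating set if every vertex of $G$ has a neighbor in $S$; the total domination number $\gamma_t(G)$ is the minimum cardinality of a total dominating set of $G$. A sequence $(v_1,\dots,v_m)$ of distinct vertices of $G$ is legal if $N(v_i)\setminus\bigcup_{j<i}N(v_j)\neq\emptyset$ for every $i\in\{2,\dots,m\}$. A legal sequence whose underlying set $\{v_1,\dots,v_m\}$ is a total dominating set of $G$ is a total dominating sequence. The Grundy total domination number $\gamma_{gr}^t(G)$ is the maximum length of a total dominating sequence in $G$. Design notions: A design is a pair $(X,\mathcal{A})$ where $X$ is a set of elements called points and $\mathcal{A}$ is a collection of nonempty subsets of $X$ called blocks. For positive integers $v,r,\lambda$ with $v>r\ge 2$, a $(v,r,\lambda)$-balanced incomplete block design (BIBD) is a design with $|X|=v$ in which each block contains exactly $r$ points and every pair of distinct points is contained in exactly $\lambda$ blocks. A projective plane of order $q$ is a $(q^2+q+1,q+1,1)$-BIBD with $q\ge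 2$. An affine plane of order $q$ is a BIBD with $|X|=q^2$ and $q^2+q$ blocks in which each block contains $q$ points, each point is contained in exactly $q+1$ blocks, and every pair of distinct points is contained in exactly one block. A Latin square of order $q$ with entries from a $q$-set $X$ is a $q\times q$ array in which every cell contains an element of $X$ and every row and every column is a permutation of $X$. Two Latin squares $L_1,L_2$ of order $q$ with entries from $X$ and $Y$, respectively, are orthogonal if for every $x\in X$ and $y\in Y$ there is a unique cell $(i,j)$ with $L_1(i,j)=x$ and $L_2(i,j)=y$. "$m$ MOLS$(q)$" means $m$ mutually (pairwise) orthogonal Latin squares of order $q$. For integers $s\ge 2$ and $q\ge 1$, an orthogonal array $OA(s,q)$ is a $q^2\times s$ array with entries from a set $X$ of cardinality $q$ such that, within any two columns, every ordered pair of symbols from $X$ occurs in exactly one row.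
   Formalization: The claims about projective and affine planes are stated for k ≠ 2 only: for k = 2, n = 3 the graph 3K_2 has all the properties, but planes of order 1 are excluded by definition; the characterizations by MOLS and orthogonal arrays are proved for all n, k. *)

theory Defs
  imports "Graph_Theory.Pair_Digraph" "HOL-Library.Multiset"
begin

text \<open>A finite simple undirected graph is a \<open>pair_graph\<close>: a finite digraph without loops or
  parallel arcs whose arc relation \<open>parcs G\<close> is symmetric.\<close>

definition nbhd :: "'a pair_pre_digraph \<Rightarrow> 'a \<Rightarrow> 'a set" where
  "nbhd G v = {u. (v, u) \<in> parcs G}"

definition no_isolated_vertices :: "'a pair_pre_digraph \<Rightarrow> bool" where
  "no_isolated_vertices G \<longleftrightarrow> (\<forall>v\<in>pverts G. nbhd G v \<noteq> {})"

definition regular :: "nat \<Rightarrow> 'a pair_pre_digraph \<Rightarrow> bool" where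
  "regular d G \<longleftrightarrow> (\<forall>v\<in>pverts G. card (nbhd G v) = d)"

definition bipartite :: "'a pair_pre_digraph \<Rightarrow> bool" where
  "bipartite G \<longleftrightarrow> (\<exists>A B. A \<union> B = pverts G \<and> A \<inter> B = {} \<and>
     (\<forall>(u, v)\<in>parcs G. u \<in> A \<and> v \<in> B \<or> u \<in> B \<and> v \<in> A))"

definition false_twins :: "'a pair_pre_digraph \<Rightarrow> 'a \<Rightarrow> 'a \<Rightarrow> bool" where
  "false_twins G u v \<longleftrightarrow> u \<in> pverts G \<and> v \<in> pverts G \<and> u \<noteq> v \<and> nbhd G u = nbhd G v"

definition false_twin_free :: "'a pair_pre_digraph \<Rightarrow> bool" where
  "false_twin_free G \<longleftrightarrow> (\<nexists>u v. false_twins G u v)"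

definition total_dominating_set :: "'a pair_pre_digraph \<Rightarrow> 'a set \<Rightarrow> bool" where
  "total_dominating_set G S \<longleftrightarrow> S \<subseteq> pverts G \<and> (\<forall>v\<in>pverts G. nbhd G v \<inter> S \<noteq> {})"

text \<open>The two domination numbers are meaningful only for finite graphs without isolated vertices:
  otherwise there is no total dominating set, and \<open>Min\<close> and \<open>Max\<close> of the empty set are
  unspecified.\<close>

definition total_domination_number :: "'a pair_pre_digraph \<Rightarrow> nat" where
  "total_domination_number G = Min {card S | S. total_dominating_set G S}"

text \<open>Sequences are lists, indexed from 0, so the legality condition starts at index 1.\<close>

definition legal :: "'a pair_pre_digraph \<Rightarrow> 'a list \<Rightarrow> bool" where
  "legal G vs \<longleftrightarrow> distinct vs \<and> set vs \<subseteq> pverts G \<and>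
     (\<forall>i\<in>{1..<length vs}. nbhd G (vs ! i) - (\<Union>j<i. nbhd G (vs ! j)) \<noteq> {})"

definition total_dominating_sequence :: "'a pair_pre_digraph \<Rightarrow> 'a list \<Rightarrow> bool" where
  "total_dominating_sequence G vs \<longleftrightarrow> legal G vs \<and> total_dominating_set G (set vs)"

definition grundy_total_domination_number :: "'a pair_pre_digraph \<Rightarrow> nat" where
  "grundy_total_domination_number G = Max {length vs | vs. total_dominating_sequence G vs}"

text \<open>The blocks of a design form a multiset, so repeated blocks are allowed and are counted
  with multiplicity.\<close>

definition design :: "'a set \<Rightarrow> 'a set multiset \<Rightarrow> bool" where
  "design X \<A> \<longleftrightarrow> (\<forall>B\<in>#\<A>. B \<noteq> {} \<and> B \<subseteq> X)"

definition bibd :: "nat \<Rightarrow> nat \<Rightarrow> nat \<Rightarrow> 'a set \<Rightarrow> 'a set multiset \<Rightarrow> bool" where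
  "bibd v r l X \<A> \<longleftrightarrow> v > r \<and> r \<ge> 2 \<and> l > 0 \<and> design X \<A> \<and> finite X \<and> card X = v \<and>
     (\<forall>B\<in>#\<A>. card B = r) \<and>
     (\<forall>x\<in>X. \<forall>y\<in>X. x \<noteq> y \<longrightarrow> size {#B \<in># \<A>. x \<in> B \<and> y \<in> B#} = l)"

definition projective_plane :: "nat \<Rightarrow> 'a set \<Rightarrow> 'a set multiset \<Rightarrow> bool" where
  "projective_plane q X \<A> \<longleftrightarrow> q \<ge> 2 \<and> bibd (q^2 + q + 1) (q + 1) 1 X \<A>"

definition affine_plane :: "nat \<Rightarrow> 'a set \<Rightarrow> 'a set multiset \<Rightarrow> bool" where
  "affine_plane q X \<A> \<longleftrightarrow> bibd (q^2) q 1 X \<A> \<and> size \<A> = q^2 + q \<and>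
     (\<forall>x\<in>X. size {#B \<in># \<A>. x \<in> B#} = q + 1)"

text \<open>Rows and columns of the arrays below are indexed from 0; values outside the array are
  irrelevant. Latin squares have positive order.\<close>

definition latin_square :: "nat \<Rightarrow> 'a set \<Rightarrow> (nat \<Rightarrow> nat \<Rightarrow> 'a) \<Rightarrow> bool" where
  "latin_square q X L \<longleftrightarrow> q \<ge> 1 \<and> finite X \<and> card X = q \<and>
     (\<forall>i<q. bij_betw (\<lambda>j. L i j) {..<q} X) \<and>
     (\<forall>j<q. bij_betw (\<lambda>i. L i j) {..<q} X)"

definition orthogonal_squares ::
    "nat \<Rightarrow> 'a set \<Rightarrow> (nat \<Rightarrow> nat \<Rightarrow> 'a) \<Rightarrow> 'b set \<Rightarrow> (nat \<Rightarrow> nat \<Rightarrow> 'b) \<Rightarrow> bool" where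
  "orthogonal_squares q X L Y M \<longleftrightarrow>
     (\<forall>x\<in>X. \<forall>y\<in>Y. \<exists>!(i, j). i < q \<and> j < q \<and> L i j = x \<and> M i j = y)"

text \<open>The condition \<open>q \<ge> 1\<close> is repeated here because it does not follow when \<open>m = 0\<close>.\<close>

definition mols :: "nat \<Rightarrow> nat \<Rightarrow> (nat \<Rightarrow> 'a set) \<Rightarrow> (nat \<Rightarrow> nat \<Rightarrow> nat \<Rightarrow> 'a) \<Rightarrow> bool" where
  "mols m q X L \<longleftrightarrow> q \<ge> 1 \<and> (\<forall>s<m. latin_square q (X s) (L s)) \<and>
     (\<forall>s<m. \<forall>t<m. s \<noteq> t \<longrightarrow> orthogonal_squares q (X s) (L s) (X t) (L t))"

definition orthogonal_array :: "nat \<Rightarrow> nat \<Rightarrow> 'a set \<Rightarrow> (nat \<Rightarrow> nat \<Rightarrow> 'a) \<Rightarrow> bool" where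
  "orthogonal_array s q X A \<longleftrightarrow> s \<ge> 2 \<and> q \<ge> 1 \<and> finite X \<and> card X = q \<and>
     (\<forall>i<q^2. \<forall>c<s. A i c \<in> X) \<and>
     (\<forall>c<s. \<forall>d<s. c \<noteq> d \<longrightarrow>
        (\<forall>x\<in>X. \<forall>y\<in>X. \<exists>!i. i < q^2 \<and> A i c = x \<and> A i d = y))"

text \<open>All structures involved are finite, so their existence can be expressed with natural
  numbers as vertices, points and symbols. Truncated subtraction causes no artefacts in the
  following definitions and their use with \<open>k - 1\<close> and \<open>k - 2\<close>: for \<open>k < 2\<close> the order becomes 0,
  and no structure of order 0 exists. Order 1 is degenerate: projective and affine planes of order 1
  are excluded by definition, but the empty family of MOLS of order 1 and an \<open>OA(2,1)\<close> exist,
  and the disjoint union of three edges is a graph of the required kind with \<open>n = 3\<close>, \<open>k = 2\<close>.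
  Hence the restriction to \<open>k \<noteq> 2\<close> wherever planes occur.\<close>

definition projective_plane_exists :: "nat \<Rightarrow> bool" where
  "projective_plane_exists q \<longleftrightarrow> (\<exists>(X :: nat set) \<A>. projective_plane q X \<A>)"

definition affine_plane_exists :: "nat \<Rightarrow> bool" where
  "affine_plane_exists q \<longleftrightarrow> (\<exists>(X :: nat set) \<A>. affine_plane q X \<A>)"

definition mols_exist :: "nat \<Rightarrow> nat \<Rightarrow> bool" where
  "mols_exist m q \<longleftrightarrow> (\<exists>(X :: nat \<Rightarrow> nat set) L. mols m q X L)"

definition orthogonal_array_exists :: "nat \<Rightarrow> nat \<Rightarrow> bool" where
  "orthogonal_array_exists s q \<longleftrightarrow> (\<exists>(X :: nat set) A. orthogonal_array s q X A)"

end

theory Submission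
  imports Defs
begin

text \<open>
  Let \<open>A\<close> and \<open>B\<close> be the sides of a bipartite graph without isolated vertices. Legality and
  domination concern the sides separately: vertices of \<open>B\<close> dominate only vertices of \<open>A\<close>, and
  conversely. Every legal sequence extends to a total dominating one, so both numbers equal 6
  exactly when total dominating sets have at least 6 elements and legal sequences at most 6
  (\<open>both_numbers_eq_iff\<close>).

  Suppose this holds. A legal sequence \<open>b\<^sub>1, \<dots>, b\<^sub>4\<close> in \<open>B\<close> whose terms dominate the new
  vertices \<open>a\<^sub>1, \<dots>, a\<^sub>4\<close> would continue with \<open>a\<^sub>4, \<dots>, a\<^sub>1\<close> to a legal sequence of length 8
  (\<open>no_legal_four\<close>); so neither side contains a legal sequence of length 4. Two vertices of
  \<open>B\<close> cannot dominate \<open>A\<close>, since four vertices of \<open>A\<close> would be needed to complete them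
  (\<open>common_nonneighbour\<close>). Hence any two vertices of \<open>B\<close> have a common non-neighbour; it is
  unique, for a vertex adjacent to just one of two common non-neighbours would start the second
  half of a legal sequence of length 4, and without false twins regularity provides such a vertex
  (\<open>meets_once_if_numbers_eq_6\<close>). By symmetry the sets of non-neighbours form a linear space in which
  lines and pencils have size \<open>k\<close>, and counting the points on the lines through a point gives
  \<open>n - 1 = k (k - 1)\<close>: a projective plane of order \<open>k - 1\<close>, or a triangle if \<open>k = 2\<close>
  (\<open>weak_plane_if_meets_once\<close>). Conversely, the non-incidence graph of a plane has these properties
  (\<open>graph_if_weak_plane\<close>).

  The design-theoretic equivalences all pass through orthogonal arrays. The \<open>q\<^sup>2\<close> points off a line
  \<open>L\<close> of a projective plane are the rows of an array whose columns are the points \<open>p\<close> of \<open>L\<close>, the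
  entry being the line joining the row to \<open>p\<close>; for an affine plane the columns are the parallel
  classes. From an array with \<open>q + 1\<close> columns one recovers lines as the sets of rows with a given
  entry in a given column, adding one point at infinity for each column in the projective case.
  Here two rows agree in exactly one column, by counting (\<open>columns_agree_once\<close>). Finally, two columns
  of an array serve as coordinates of the cells in which the remaining columns are mutually
  orthogonal Latin squares.
\<close>

section \<open>Linear spaces with constant block size\<close>

text \<open>Projective planes, the triangle and affine planes differ only in the numbers of points and
  of points per block, so the counting arguments are made once for all of them.\<close>

locale linear_space =
  fixes X :: "'a set" and \<B> :: "'a set set" and r :: nat
  assumes finite_points: "finite X"
    and block_size_ge_2: "2 \<le> r"
    and block_subset: "B \<in> \<B> \<Longrightarrow> B \<subseteq> X"
    and card_block: "B \<in> \<B> \<Longrightarrow> card B = r"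
    and unique_join: "x \<in> X \<Longrightarrow> y \<in> X \<Longrightarrow> x \<noteq> y \<Longrightarrow> \<exists>!B. B \<in> \<B> \<and> x \<in> B \<and> y \<in> B"
begin

definition pencil :: "'a \<Rightarrow> 'a set set" where
  "pencil x = {B \<in> \<B>. x \<in> B}"

definition join :: "'a \<Rightarrow> 'a \<Rightarrow> 'a set" where
  "join x y = (THE B. B \<in> \<B> \<and> x \<in> B \<and> y \<in> B)"

lemma join:
  assumes "x \<in> X" "y \<in> X" "x \<noteq> y"
  shows "join x y \<in> \<B>" "x \<in> join x y" "y \<in> join x y"
  using theI'[OF unique_join[OF assms]] unfolding join_def by auto

lemma join_eqI:
  assumes "B \<in> \<B>" "x \<in> B" "y \<in> B" "x \<noteq> y"
  shows "join x y = B"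
  using unique_join[of x y] block_subset[OF assms(1)] assms join[of x y] by blast

lemma common_point_unique:
  assumes "B \<in> \<B>" "C \<in> \<B>" "B \<noteq> C" "x \<in> B" "x \<in> C" "y \<in> B" "y \<in> C"
  shows "x = y"
  using assms join_eqI by metis

lemma finite_block: "B \<in> \<B> \<Longrightarrow> finite B"
  using block_subset finite_points finite_subset by blast

lemma finite_blocks: "finite \<B>"
  using block_subset finite_points by (intro finite_subset[of \<B> "Pow X"]) auto

lemma block_nonempty: "B \<in> \<B> \<Longrightarrow> B \<noteq> {}"
  using card_block block_size_ge_2 by fastforce

text \<open>The blocks through a point partition the other points.\<close>

lemma card_pencil:
  assumes "x \<in> X"
  shows "card (pencil x) * (r - 1) = card X - 1"
proof -
  have "X - {x} = (\<Union>B\<in>pencil x. B - {x})"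
  proof
    show "X - {x} \<subseteq> (\<Union>B\<in>pencil x. B - {x})"
    proof
      fix y assume "y \<in> X - {x}"
      then show "y \<in> (\<Union>B\<in>pencil x. B - {x})"
        using join[of x y] assms by (auto simp: pencil_def)
    qed
    show "(\<Union>B\<in>pencil x. B - {x}) \<subseteq> X - {x}"
      using block_subset by (auto simp: pencil_def)
  qed
  also have "card \<dots> = (\<Sum>B\<in>pencil x. card (B - {x}))"
  proof (rule card_UN_disjoint)
    show "finite (pencil x)" using finite_blocks by (simp add: pencil_def)
    show "\<forall>B\<in>pencil x. finite (B - {x})" using finite_block by (auto simp: pencil_def)
    show "\<forall>B\<in>pencil x. \<forall>C\<in>pencil x. B \<noteq> C \<longrightarrow> (B - {x}) \<inter> (C - {x}) = {}"
      using common_point_unique unfolding pencil_def by blast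
  qed
  also have "\<dots> = card (pencil x) * (r - 1)"
    using card_block finite_block by (simp add: pencil_def card_Diff_singleton)
  finally show ?thesis using assms finite_points by simp
qed

text \<open>Double counting of flags.\<close>

lemma card_blocks_mult:
  assumes "\<And>x. x \<in> X \<Longrightarrow> card (pencil x) = d"
  shows "card \<B> * r = card X * d"
proof -
  have "card \<B> * r = (\<Sum>B\<in>\<B>. card {x \<in> X. x \<in> B})"
  proof -
    have "card {x \<in> X. x \<in> B} = r" if "B \<in> \<B>" for B
    proof -
      have "{x \<in> X. x \<in> B} = B" using block_subset[OF that] by auto
      then show ?thesis using card_block[OF that] by simp
    qed
    then show ?thesis by simp
  qed
  also have "\<dots> = (\<Sum>x\<in>X. card {B \<in> \<B>. x \<in> B})"
    using sum_multicount_gen[of \<B> X "\<lambda>B x. x \<in> B" "\<lambda>x. card {B \<in> \<B>. x \<in> B}"]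
      finite_blocks finite_points by simp
  also have "\<dots> = card X * d"
    using assms by (simp add: pencil_def)
  finally show ?thesis .
qed

text \<open>Joining \<open>x\<close> to the points of \<open>B\<close> yields exactly once each block through \<open>x\<close> that meets
  \<open>B\<close>.
  Comparison with the size of the pencil shows that lines of a projective plane always meet, and
  that in an affine plane exactly one line through \<open>x\<close> misses \<open>B\<close>.\<close>

lemma card_meeting_pencil:
  assumes "B \<in> \<B>" "x \<in> X" "x \<notin> B"
  shows "card {C \<in> pencil x. C \<inter> B \<noteq> {}} = r"
proof -
  have "bij_betw (join x) B {C \<in> pencil x. C \<inter> B \<noteq> {}}"
  proof (intro bij_betw_imageI inj_onI equalityI subsetI)
    fix y z assume yz: "y \<in> B" "z \<in> B" "join x y = join x z"
    have ne: "x \<noteq> y" "x \<noteq> z" using yz assms by auto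
    have "y \<in> X" "z \<in> X" using yz block_subset[OF assms(1)] by auto
    then have "join x y \<in> \<B>" "x \<in> join x y" "y \<in> join x y" "z \<in> join x y"
      using join[of x y] join[of x z] ne assms yz by auto
    then show "y = z" using common_point_unique[of B "join x y" y z] assms yz by blast
  next
    fix C assume "C \<in> join x ` B"
    then obtain y where y: "y \<in> B" "C = join x y" by auto
    then have "x \<noteq> y" "y \<in> X" using assms block_subset by auto
    then show "C \<in> {C \<in> pencil x. C \<inter> B \<noteq> {}}"
      using join[of x y] y assms by (auto simp: pencil_def)
  next
    fix C assume "C \<in> {C \<in> pencil x. C \<inter> B \<noteq> {}}"
    then obtain y where y: "C \<in> \<B>" "x \<in> C" "y \<in> C" "y \<in> B" by (auto simp: pencil_def)
    then have "join x y = C" using assms by (intro join_eqI) auto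
    then show "C \<in> join x ` B" using y by auto
  qed
  then show ?thesis using bij_betw_same_card[of "join x"] card_block[OF assms(1)] by simp
qed

end

text \<open>With \<open>\<lambda> = 1\<close> and blocks of size at least 2, no block is repeated, so the passage between
  multisets and sets of blocks loses nothing.\<close>

lemma linear_space_if_bibd:
  assumes "bibd v r 1 X \<A>"
  shows "linear_space X (set_mset \<A>) r"
proof
  show "finite X" "2 \<le> r" using assms by (auto simp: bibd_def)
  show "B \<subseteq> X" "card B = r" if "B \<in># \<A>" for B
    using assms that by (auto simp: bibd_def design_def)
  fix x y assume "x \<in> X" "y \<in> X" "x \<noteq> y"
  then have "size {#B \<in># \<A>. x \<in> B \<and> y \<in> B#} = 1" using assms by (auto simp: bibd_def)
  then obtain B where "{#B \<in># \<A>. x \<in> B \<and> y \<in> B#} = {#B#}"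
    using size_1_singleton_mset by blast
  then have "set_mset {#B \<in># \<A>. x \<in> B \<and> y \<in> B#} = {B}" by simp
  then have "(C \<in># \<A> \<and> x \<in> C \<and> y \<in> C) = (C = B)" for C
    by (simp add: set_eq_iff)
  then show "\<exists>!B. B \<in># \<A> \<and> x \<in> B \<and> y \<in> B" by simp
qed

lemma bibd_if_linear_space:
  assumes "linear_space X \<B> r" "r < card X"
  shows "bibd (card X) r 1 X (mset_set \<B>)"
proof -
  interpret linear_space X \<B> r by fact
  have "size {#B \<in># mset_set \<B>. x \<in> B \<and> y \<in> B#} = 1" if xy: "x \<in> X" "y \<in> X" "x \<noteq> y" for x y
  proof -
    obtain B where "B \<in> \<B>" "x \<in> B" "y \<in> B" using unique_join[OF xy] by auto
    then have "{B \<in> \<B>. x \<in> B \<and> y \<in> B} = {B}" using unique_join[OF xy] by auto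
    then show ?thesis by (simp add: filter_mset_mset_set finite_blocks)
  qed
  then show ?thesis
    using assms(2) block_size_ge_2 finite_points block_subset card_block block_nonempty
    by (auto simp: bibd_def design_def finite_blocks)
qed

section \<open>Projective planes and the triangle\<close>

text \<open>Order 1 is admitted here: the corresponding structure, the triangle, is the one that belongs
  to the graph with \<open>k = 2\<close> and to the array \<open>OA(2, 1)\<close>.\<close>

locale weak_plane = linear_space X \<B> "q + 1" for X :: "'a set" and \<B> q +
  assumes card_points: "card X = q\<^sup>2 + q + 1"
begin

lemma order_pos: "1 \<le> q"
  using block_size_ge_2 by simp

lemma card_pencil_plane:
  assumes "x \<in> X"
  shows "card (pencil x) = q + 1"
proof -
  have "card (pencil x) * q = (q + 1) * q"
    using card_pencil[OF assms] card_points by (simp add: power2_eq_square)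
  moreover have "q \<noteq> 0" using order_pos by simp
  ultimately show ?thesis by (metis mult_cancel2)
qed

lemma card_blocks: "card \<B> = q\<^sup>2 + q + 1"
proof -
  have "card \<B> * (q + 1) = (q\<^sup>2 + q + 1) * (q + 1)"
    using card_blocks_mult[OF card_pencil_plane] card_points by simp
  then show ?thesis by (metis mult_cancel2 add_is_0 one_neq_zero)
qed

lemma blocks_meet:
  assumes "B \<in> \<B>" "C \<in> \<B>"
  shows "B \<inter> C \<noteq> {}"
proof -
  obtain x where x: "x \<in> B" using block_nonempty[OF assms(1)] by auto
  then have xX: "x \<in> X" using block_subset assms by auto
  show ?thesis
  proof (cases "x \<in> C")
    case False
    have "finite (pencil x)" using finite_blocks by (simp add: pencil_def)
    then have "{D \<in> pencil x. D \<inter> C \<noteq> {}} = pencil x"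
      using card_meeting_pencil[OF assms(2) xX False] card_pencil_plane[OF xX]
      by (intro card_subset_eq) auto
    then show ?thesis using x assms by (auto simp: pencil_def)
  qed (use x in auto)
qed

end

lemma projective_plane_iff_weak_plane:
  assumes "q \<noteq> 1"
  shows "projective_plane_exists q \<longleftrightarrow> (\<exists>(X :: nat set) \<B>. weak_plane X \<B> q)"
proof
  assume "projective_plane_exists q"
  then obtain X :: "nat set" and \<A> where bibd: "bibd (q\<^sup>2 + q + 1) (q + 1) 1 X \<A>"
    by (auto simp: projective_plane_exists_def projective_plane_def)
  have "linear_space X (set_mset \<A>) (q + 1)" "card X = q\<^sup>2 + q + 1"
    using linear_space_if_bibd[OF bibd] bibd by (simp_all add: bibd_def)
  then have "weak_plane X (set_mset \<A>) q"
    by (simp add: weak_plane_def weak_plane_axioms_def)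
  then show "\<exists>(X :: nat set) \<B>. weak_plane X \<B> q" by blast
next
  assume "\<exists>(X :: nat set) \<B>. weak_plane X \<B> q"
  then obtain X :: "nat set" and \<B> where "weak_plane X \<B> q" by blast
  then interpret weak_plane X \<B> q .
  have "2 \<le> q" using order_pos assms by simp
  moreover have "q + 1 < card X" using order_pos by (simp add: card_points)
  then have "bibd (q\<^sup>2 + q + 1) (q + 1) 1 X (mset_set \<B>)"
    using bibd_if_linear_space[OF linear_space_axioms] card_points by simp
  ultimately show "projective_plane_exists q"
    by (auto simp: projective_plane_exists_def projective_plane_def)
qed

section \<open>Orthogonal arrays from coordinate systems\<close>

text \<open>The rows of an array may be indexed by any set of size \<open>q\<^sup>2\<close>, and each column may have an
  alphabet of its own: the condition on two columns is invariant under separate relabellings.\<close>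

lemma orthogonal_array_existsI:
  fixes P :: "'a set" and S :: "nat \<Rightarrow> 'b set" and f :: "nat \<Rightarrow> 'a \<Rightarrow> 'b"
  assumes "2 \<le> s" "1 \<le> q" "card P = q\<^sup>2"
    and card_S: "\<And>c. c < s \<Longrightarrow> card (S c) = q"
    and f_in: "\<And>c p. c < s \<Longrightarrow> p \<in> P \<Longrightarrow> f c p \<in> S c"
    and unique: "\<And>c d x y. c < s \<Longrightarrow> d < s \<Longrightarrow> c \<noteq> d \<Longrightarrow> x \<in> S c \<Longrightarrow> y \<in> S d \<Longrightarrow>
      \<exists>!p. p \<in> P \<and> f c p = x \<and> f d p = y"
  shows "orthogonal_array_exists s q"
proof -
  have "finite P" using assms(2,3) by (intro card_ge_0_finite) simp
  then obtain e where e: "bij_betw e {..<q\<^sup>2} P"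
    using ex_bij_betw_nat_finite[of P] assms(3) by (auto simp: atLeast0LessThan)
  have "\<exists>h. bij_betw h (S c) {..<q}" if "c < s" for c
  proof -
    have "finite (S c)" using card_S[OF that] assms(2) by (intro card_ge_0_finite) simp
    then show ?thesis
      using ex_bij_betw_finite_nat[of "S c"] card_S[OF that] by (auto simp: atLeast0LessThan)
  qed
  then obtain h where h: "\<And>c. c < s \<Longrightarrow> bij_betw (h c) (S c) {..<q}" by metis
  have "orthogonal_array s q {..<q} (\<lambda>i c. h c (f c (e i)))"
    unfolding orthogonal_array_def
  proof (intro conjI allI impI ballI)
    show "h c (f c (e i)) \<in> {..<q}" if "i < q\<^sup>2" "c < s" for i c
      using bij_betw_apply[OF h] f_in bij_betw_apply[OF e] that by simp
    fix c d x y assume cd: "c < s" "d < s" "c \<noteq> d" and xy: "x \<in> {..<q}" "y \<in> {..<q}"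
    obtain x' where x': "x' \<in> S c" "h c x' = x"
      using h[OF cd(1)] xy(1) by (metis bij_betw_imp_surj_on imageE)
    obtain y' where y': "y' \<in> S d" "h d y' = y"
      using h[OF cd(2)] xy(2) by (metis bij_betw_imp_surj_on imageE)
    obtain p where p: "p \<in> P" "f c p = x'" "f d p = y'"
      using unique[OF cd x'(1) y'(1)] by blast
    obtain i where i: "i < q\<^sup>2" "e i = p"
      using e p(1) by (metis bij_betw_imp_surj_on imageE lessThan_iff)
    show "\<exists>!i. i < q\<^sup>2 \<and> h c (f c (e i)) = x \<and> h d (f d (e i)) = y"
    proof (rule ex1I[of _ i])
      show "i < q\<^sup>2 \<and> h c (f c (e i)) = x \<and> h d (f d (e i)) = y"
        using i p x' y' by simp
      fix j assume j: "j < q\<^sup>2 \<and> h c (f c (e j)) = x \<and> h d (f d (e j)) = y"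
      then have ej: "e j \<in> P" using bij_betw_apply[OF e] by simp
      have "f c (e j) = x'"
        using inj_onD[OF bij_betw_imp_inj_on[OF h[OF cd(1)]], of "f c (e j)" x'] j x' f_in cd ej by simp
      moreover have "f d (e j) = y'"
        using inj_onD[OF bij_betw_imp_inj_on[OF h[OF cd(2)]], of "f d (e j)" y'] j y' f_in cd ej by simp
      ultimately have "e j = p" using unique[OF cd x'(1) y'(1)] ej p by blast
      then show "j = i"
        using inj_onD[OF bij_betw_imp_inj_on[OF e], of j i] i j by simp
    qed
  qed (use assms in auto)
  then show ?thesis by (auto simp: orthogonal_array_exists_def)
qed

text \<open>A net: each class partitions the points, and blocks of distinct classes meet exactly once. The
  entry of column \<open>c\<close> in row \<open>p\<close> is the block of class \<open>c\<close> through \<open>p\<close>.\<close>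

lemma orthogonal_array_exists_if_net:
  fixes P :: "'a set" and S :: "nat \<Rightarrow> 'a set set"
  assumes "2 \<le> s" "1 \<le> q" "card P = q\<^sup>2"
    and card_S: "\<And>c. c < s \<Longrightarrow> card (S c) = q"
    and cover: "\<And>c p. c < s \<Longrightarrow> p \<in> P \<Longrightarrow> \<exists>!B. B \<in> S c \<and> p \<in> B"
    and meet: "\<And>c d B C. c < s \<Longrightarrow> d < s \<Longrightarrow> c \<noteq> d \<Longrightarrow> B \<in> S c \<Longrightarrow> C \<in> S d \<Longrightarrow>
      \<exists>!p. p \<in> P \<and> p \<in> B \<and> p \<in> C"
  shows "orthogonal_array_exists s q"
proof -
  define f where "f c p = (THE B. B \<in> S c \<and> p \<in> B)" for c p
  have f: "f c p \<in> S c" "f c p = B \<longleftrightarrow> p \<in> B" if "c < s" "p \<in> P" "B \<in> S c" for c p B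
    using theI'[OF cover[OF that(1,2)]] cover[OF that(1,2)] that(3) unfolding f_def by auto
  show ?thesis
  proof (rule orthogonal_array_existsI[OF assms(1-3), of S f])
    show "f c p \<in> S c" if "c < s" "p \<in> P" for c p
      using f(1) cover that by blast
    show "\<exists>!p. p \<in> P \<and> f c p = x \<and> f d p = y"
      if "c < s" "d < s" "c \<noteq> d" "x \<in> S c" "y \<in> S d" for c d x y
      using meet[OF that] f(2)[OF that(1) _ that(4)] f(2)[OF that(2) _ that(5)] by metis
  qed (rule card_S)
qed

text \<open>The classes are the pencils of the points of a line \<open>L\<close>, with \<open>L\<close> itself removed. Two lines
  from distinct pencils meet outside \<open>L\<close>, because each of them meets \<open>L\<close> only in the centre of its
  pencil.\<close>

lemma (in weak_plane) orthogonal_array_of_plane: "orthogonal_array_exists (q + 1) q"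
proof -
  have "2 \<le> card X" using order_pos by (simp add: card_points)
  then obtain a b where ab: "a \<in> X" "b \<in> X" "a \<noteq> b"
    by (metis card_le_Suc0_iff_eq finite_points not_less_eq_eq numeral_2_eq_2)
  define L where "L = join a b"
  have L: "L \<in> \<B>" using join[OF ab] by (simp add: L_def)
  have fL: "finite L" "card L = q + 1" "L \<subseteq> X"
    using finite_block card_block block_subset L by auto
  obtain e where e: "bij_betw e {..<q + 1} L"
    using ex_bij_betw_nat_finite[OF fL(1)] fL(2) by (auto simp: atLeast0LessThan)
  have eL: "e c \<in> L" "e c \<in> X" if "c < q + 1" for c
    using bij_betw_apply[OF e] that fL(3) by auto
  show ?thesis
  proof (rule orthogonal_array_exists_if_net[of _ _ "X - L" "\<lambda>c. pencil (e c) - {L}"])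
    show "card (X - L) = q\<^sup>2"
      using fL by (simp add: card_Diff_subset card_points)
  next
    fix c assume c: "c < q + 1"
    then show "card (pencil (e c) - {L}) = q"
      using card_pencil_plane[of "e c"] eL L by (simp add: pencil_def)
    fix p assume p: "p \<in> X - L"
    then have "p \<noteq> e c" using eL c by auto
    then show "\<exists>!B. B \<in> pencil (e c) - {L} \<and> p \<in> B"
      using unique_join[of "e c" p] eL(2)[OF c] p by (auto simp: pencil_def)
  next
    fix c d B C
    assume cd: "c < q + 1" "d < q + 1" "c \<noteq> d"
      and B: "B \<in> pencil (e c) - {L}" and C: "C \<in> pencil (e d) - {L}"
    have ne: "e c \<noteq> e d"
      using inj_onD[OF bij_betw_imp_inj_on[OF e], of c d] cd by auto
    have *: "B \<in> \<B>" "C \<in> \<B>" "e c \<in> B" "e d \<in> C" "B \<noteq> L" "C \<noteq> L"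
      using B C by (auto simp: pencil_def)
    then have "B \<noteq> C"
      using common_point_unique[of B L "e c" "e d"] ne L eL cd by auto
    moreover obtain p where p: "p \<in> B" "p \<in> C" using blocks_meet * by blast
    moreover have "p \<notin> L"
      using common_point_unique[of B L p "e c"] common_point_unique[of C L p "e d"] ne L eL cd p *
      by auto
    moreover have "p \<in> X" using p * block_subset by auto
    ultimately show "\<exists>!p. p \<in> X - L \<and> p \<in> B \<and> p \<in> C"
      using common_point_unique[of B C] * by blast
  qed (use order_pos in auto)
qed

section \<open>Affine planes\<close>

locale affine_space = linear_space X \<B> q for X :: "'a set" and \<B> q +
  assumes card_points: "card X = q\<^sup>2"
begin

lemma card_pencil_affine:
  assumes "x \<in> X"
  shows "card (pencil x) = q + 1"
proof -
  have "q\<^sup>2 - 1 = (q + 1) * (q - 1)"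
    by (cases q) (simp_all add: power2_eq_square)
  then have "card (pencil x) * (q - 1) = (q + 1) * (q - 1)"
    using card_pencil[OF assms] card_points by simp
  moreover have "q - 1 \<noteq> 0" using block_size_ge_2 by simp
  ultimately show ?thesis by (metis mult_cancel2)
qed

lemma playfair:
  assumes "B \<in> \<B>" "x \<in> X" "x \<notin> B"
  shows "\<exists>!C. C \<in> \<B> \<and> x \<in> C \<and> C \<inter> B = {}"
proof -
  have fin: "finite (pencil x)" using finite_blocks by (simp add: pencil_def)
  have "{C \<in> \<B>. x \<in> C \<and> C \<inter> B = {}} = pencil x - {C \<in> pencil x. C \<inter> B \<noteq> {}}"
    by (auto simp: pencil_def)
  also have "card \<dots> = (q + 1) - q"
    using card_meeting_pencil[OF assms] card_pencil_affine[OF assms(2)] fin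
    by (subst card_Diff_subset) auto
  finally have "card {C \<in> \<B>. x \<in> C \<and> C \<inter> B = {}} = 1" by simp
  then obtain C where "{C \<in> \<B>. x \<in> C \<and> C \<inter> B = {}} = {C}" by (auto simp: card_1_singleton_iff)
  then have "(D \<in> \<B> \<and> x \<in> D \<and> D \<inter> B = {}) = (D = C)" for D
    by (simp add: set_eq_iff[of _ "{C}"])
  then show ?thesis by simp
qed

definition parallel :: "'a set \<Rightarrow> 'a set set" where
  "parallel B = {C \<in> \<B>. C = B \<or> C \<inter> B = {}}"

lemma parallel_cover:
  assumes "B \<in> \<B>" "x \<in> X"
  shows "\<exists>!C. C \<in> parallel B \<and> x \<in> C"
proof (cases "x \<in> B")
  case True
  then show ?thesis using assms by (auto simp: parallel_def)
next
  case False
  then show ?thesis using playfair[OF assms False] by (auto simp: parallel_def)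
qed

text \<open>If two lines of different classes were disjoint, then transitivity of parallelism, which is the
  uniqueness in \<open>playfair\<close>, would make the intersecting lines \<open>B\<close> and \<open>B'\<close> parallel. The argument
  is used twice: it replaces first \<open>B\<close> by \<open>C\<close> and then \<open>B'\<close> by \<open>C'\<close>.\<close>

lemma parallel_meet:
  assumes "B \<in> \<B>" "B' \<in> \<B>" "B \<noteq> B'" "B \<inter> B' \<noteq> {}" "C \<in> parallel B" "C' \<in> parallel B'"
  shows "\<exists>!x. x \<in> X \<and> x \<in> C \<and> x \<in> C'"
proof -
  have C: "C \<in> \<B>" "C' \<in> \<B>" using assms by (auto simp: parallel_def)
  have CX: "C \<subseteq> X" using C block_subset by auto
  have sym: "D \<in> parallel E \<Longrightarrow> E \<in> \<B> \<Longrightarrow> E \<in> parallel D" for D E by (auto simp: parallel_def)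
  have CB: "B \<in> parallel C" "B' \<in> parallel C'" using sym assms by auto
  have eq: "D = E" if "B \<in> \<B>" "D \<in> parallel B" "E \<in> parallel B" "x \<in> D" "x \<in> E" for D E B x
  proof -
    have "x \<in> X" using that block_subset by (auto simp: parallel_def)
    then show ?thesis using parallel_cover[of B x] that by auto
  qed
  have meet: "D \<inter> E \<noteq> {}" if "D \<in> parallel B" "E \<in> \<B>" "E \<inter> B \<noteq> {}" "E \<notin> parallel B" for D E
  proof
    assume "D \<inter> E = {}"
    then have ED: "E \<in> parallel D" using that by (auto simp: parallel_def)
    obtain z where z: "z \<in> E" "z \<in> B" using \<open>E \<inter> B \<noteq> {}\<close> by auto
    have "B \<in> parallel D" using sym that assms by auto
    moreover have "D \<in> \<B>" using that by (auto simp: parallel_def)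
    ultimately have "E = B" using eq[of D E B z] ED z by simp
    then show False using that by (auto simp: parallel_def)
  qed
  have "C \<inter> B' \<noteq> {}" using meet[OF assms(5,2)] assms by (auto simp: parallel_def)
  have "C \<inter> C' \<noteq> {}"
  proof
    assume "C \<inter> C' = {}"
    then have "C \<in> parallel C'" using C by (auto simp: parallel_def)
    moreover obtain z where "z \<in> C" "z \<in> B'" using \<open>C \<inter> B' \<noteq> {}\<close> by auto
    ultimately have "C = B'" using eq[of C' C B' z] CB C by simp
    then show False using assms by (auto simp: parallel_def)
  qed
  moreover have "C \<noteq> C'"
  proof
    assume "C = C'"
    obtain z where "z \<in> B" "z \<in> B'" using assms by auto
    then show False
      using eq[of C B B' z] CB \<open>C = C'\<close> C assms(3) by simp
  qed
  ultimately show ?thesis using common_point_unique[OF C] CX by blast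
qed

text \<open>The lines through one point \<open>z\<close> represent the \<open>q + 1\<close> parallel classes.\<close>

lemma orthogonal_array_of_affine_space: "orthogonal_array_exists (q + 1) q"
proof -
  have q: "2 \<le> q" by (rule block_size_ge_2)
  then have "0 < card X" by (simp add: card_points)
  then obtain z where o: "z \<in> X" by (metis card.empty equals0I less_irrefl)
  have "finite (pencil z)" using finite_blocks by (simp add: pencil_def)
  then obtain e where e: "bij_betw e {..<q + 1} (pencil z)"
    using ex_bij_betw_nat_finite[of "pencil z"] card_pencil_affine[OF o]
    by (auto simp: atLeast0LessThan)
  have eB: "e c \<in> \<B>" "z \<in> e c" if "c < q + 1" for c
    using bij_betw_apply[OF e] that by (auto simp: pencil_def)
  have ne: "e c \<noteq> e d" if "c < q + 1" "d < q + 1" "c \<noteq> d" for c d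
    using inj_onD[OF bij_betw_imp_inj_on[OF e], of c d] that by auto
  have meet: "\<exists>!p. p \<in> X \<and> p \<in> B \<and> p \<in> C"
    if "c < q + 1" "d < q + 1" "c \<noteq> d" "B \<in> parallel (e c)" "C \<in> parallel (e d)" for c d B C
    using parallel_meet[of "e c" "e d" B C] eB ne that by blast
  show ?thesis
  proof (rule orthogonal_array_exists_if_net[of _ _ X "\<lambda>c. parallel (e c)"])
    show "card (parallel (e c)) = q" if c: "c < q + 1" for c
    proof -
      obtain d where d: "d < q + 1" "c \<noteq> d" using q that[of "if c = 0 then 1 else 0"] by (cases "c = 0") auto
      \<comment> \<open>The line \<open>e d\<close> is a transversal of the parallel class of \<open>e c\<close>.\<close>
      define f where "f x = (THE C. C \<in> parallel (e c) \<and> x \<in> C)" for x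
      have f: "f x \<in> parallel (e c)" "x \<in> f x" if "x \<in> X" for x
        using theI'[OF parallel_cover[OF eB(1)[OF c] that]] unfolding f_def by auto
      have sub: "e d \<subseteq> X" and self: "e d \<in> parallel (e d)"
        using eB(1)[OF d(1)] block_subset by (auto simp: parallel_def)
      have "bij_betw f (e d) (parallel (e c))"
      proof (intro bij_betw_imageI inj_onI equalityI subsetI)
        fix x y assume "x \<in> e d" "y \<in> e d" "f x = f y"
        then show "x = y" using meet[OF c d, of "f x" "e d"] f[of x] f[of y] self sub by blast
      next
        fix C assume "C \<in> f ` e d"
        then show "C \<in> parallel (e c)" using f sub by auto
      next
        fix C assume C: "C \<in> parallel (e c)"
        then obtain x where x: "x \<in> X" "x \<in> C" "x \<in> e d" using meet[OF c d C self] by blast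
        then have "f x = C" using parallel_cover[OF eB(1)[OF c] x(1)] f[OF x(1)] C by blast
        then show "C \<in> f ` e d" using x by auto
      qed
      then show ?thesis using bij_betw_same_card[of f] card_block[OF eB(1)[OF d(1)]] by simp
    qed
  qed (use q card_points parallel_cover eB meet in auto)
qed

end

lemma affine_plane_if_affine_space:
  assumes "affine_space X \<B> q"
  shows "affine_plane q X (mset_set \<B>)"
proof -
  interpret affine_space X \<B> q by fact
  have "card \<B> * q = (q\<^sup>2 + q) * q"
    using card_blocks_mult[OF card_pencil_affine] card_points
    by (simp add: power2_eq_square algebra_simps)
  moreover have "q \<noteq> 0" using block_size_ge_2 by simp
  ultimately have "card \<B> = q\<^sup>2 + q" by (metis mult_cancel2)
  moreover have "q < card X" using block_size_ge_2 by (simp add: card_points power2_eq_square)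
  then have "bibd (q\<^sup>2) q 1 X (mset_set \<B>)"
    using bibd_if_linear_space[OF linear_space_axioms] card_points by simp
  ultimately show ?thesis
    using card_pencil_affine finite_blocks
    by (simp add: affine_plane_def filter_mset_mset_set pencil_def)
qed

lemma orthogonal_array_exists_if_affine_plane_exists:
  assumes "affine_plane_exists q"
  shows "orthogonal_array_exists (q + 1) q"
proof -
  obtain X :: "nat set" and \<A> where bibd: "bibd (q\<^sup>2) q 1 X \<A>"
    using assms by (auto simp: affine_plane_exists_def affine_plane_def)
  have "linear_space X (set_mset \<A>) q" "card X = q\<^sup>2"
    using linear_space_if_bibd[OF bibd] bibd by (simp_all add: bibd_def)
  then interpret affine_space X "set_mset \<A>" q
    by (simp add: affine_space_def affine_space_axioms_def)
  show ?thesis by (rule orthogonal_array_of_affine_space)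
qed

section \<open>Planes from orthogonal arrays\<close>

locale array =
  fixes X :: "'a set" and A :: "nat \<Rightarrow> nat \<Rightarrow> 'a" and s q :: nat
  assumes array: "orthogonal_array s q X A"
begin

lemma s_ge_2: "2 \<le> s" and q_pos: "1 \<le> q" and finite_X: "finite X" and card_X: "card X = q"
  using array by (auto simp: orthogonal_array_def)

lemma entry: "i < q\<^sup>2 \<Longrightarrow> c < s \<Longrightarrow> A i c \<in> X"
  using array by (auto simp: orthogonal_array_def)

lemma unique_row:
  "c < s \<Longrightarrow> d < s \<Longrightarrow> c \<noteq> d \<Longrightarrow> x \<in> X \<Longrightarrow> y \<in> X \<Longrightarrow>
    \<exists>!i. i < q\<^sup>2 \<and> A i c = x \<and> A i d = y"
  using array unfolding orthogonal_array_def by blast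

lemma row_eqI:
  assumes "c < s" "d < s" "c \<noteq> d" "i < q\<^sup>2" "j < q\<^sup>2" "A i c = A j c" "A i d = A j d"
  shows "i = j"
  using unique_row[OF assms(1-3) entry[OF assms(4,1)] entry[OF assms(4,2)]] assms by metis

end

text \<open>With \<open>q + 1\<close> columns there are just enough of them for any two rows to agree somewhere.\<close>

locale full_array = array X A "q + 1" q for X :: "'a set" and A q
begin

definition fibre :: "nat \<Rightarrow> 'a \<Rightarrow> nat set" where
  "fibre c x = {i. i < q\<^sup>2 \<and> A i c = x}"

lemma finite_fibre: "finite (fibre c x)"
  by (simp add: fibre_def)

text \<open>The entry in a second column identifies the rows of a fibre with the symbols.\<close>

lemma card_fibre:
  assumes "c < q + 1" "x \<in> X"
  shows "card (fibre c x) = q"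
proof -
  obtain d where d: "d < q + 1" "c \<noteq> d"
    using q_pos that[of "if c = 0 then 1 else 0"] by (cases "c = 0") auto
  have "bij_betw (\<lambda>i. A i d) (fibre c x) X"
  proof (intro bij_betw_imageI inj_onI equalityI subsetI)
    fix i j assume "i \<in> fibre c x" "j \<in> fibre c x" "A i d = A j d"
    then show "i = j"
      using unique_row[OF assms(1) d assms(2) entry[of i d]] d by (auto simp: fibre_def)
  next
    fix y assume "y \<in> X"
    then obtain i where "i < q\<^sup>2" "A i c = x" "A i d = y"
      using unique_row[OF assms(1) d assms(2)] by blast
    then show "y \<in> (\<lambda>i. A i d) ` fibre c x" by (auto simp: fibre_def)
  qed (use entry d in \<open>auto simp: fibre_def\<close>)
  then show ?thesis using bij_betw_same_card card_X by fastforce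
qed

text \<open>For each of the \<open>q + 1\<close> columns, \<open>q - 1\<close> other rows agree with row \<open>i\<close> there, and different
  columns give disjoint sets of rows. As \<open>(q + 1) (q - 1) = q\<^sup>2 - 1\<close>, these are all the other
  rows.\<close>

lemma columns_agree_once:
  assumes "i < q\<^sup>2" "j < q\<^sup>2" "i \<noteq> j"
  shows "\<exists>!c. c < q + 1 \<and> A i c = A j c"
proof -
  define E where "E c = fibre c (A i c) - {i}" for c
  have disj: "E c \<inter> E d = {}" if "c < q + 1" "d < q + 1" "c \<noteq> d" for c d
    using unique_row[OF that entry[OF assms(1) that(1)] entry[OF assms(1) that(2)]] assms(1)
    by (auto simp: E_def fibre_def)
  have "card (E c) = q - 1" if "c < q + 1" for c
    using card_fibre[OF that entry[OF assms(1) that]] assms(1) finite_fibre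
    by (simp add: E_def fibre_def)
  then have "card (\<Union>c<q + 1. E c) = (q + 1) * (q - 1)"
    using disj by (subst card_UN_disjoint) (auto simp: E_def finite_fibre)
  also have "\<dots> = card ({..<q\<^sup>2} - {i})"
    using assms(1) by (cases q) (simp_all add: power2_eq_square)
  finally have "(\<Union>c<q + 1. E c) = {..<q\<^sup>2} - {i}"
    by (intro card_subset_eq) (auto simp: E_def fibre_def)
  moreover have "j \<in> {..<q\<^sup>2} - {i}" using assms by simp
  ultimately obtain c where c: "c < q + 1" "j \<in> E c" by blast
  show ?thesis
  proof (rule ex1I[of _ c])
    show "c < q + 1 \<and> A i c = A j c" using c by (simp add: E_def fibre_def)
    fix d assume d: "d < q + 1 \<and> A i d = A j d"
    then have "j \<in> E d" using assms by (simp add: E_def fibre_def)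
    then show "d = c" using disj[of d c] c d by blast
  qed
qed

lemma affine_space_of_array:
  assumes "2 \<le> q"
  shows "affine_space {..<q\<^sup>2} {fibre c x | c x. c < q + 1 \<and> x \<in> X} q"
proof (intro affine_space.intro linear_space.intro affine_space_axioms.intro)
  fix B assume "B \<in> {fibre c x | c x. c < q + 1 \<and> x \<in> X}"
  then show "B \<subseteq> {..<q\<^sup>2}" "card B = q" using card_fibre by (auto simp: fibre_def)
next
  fix i j assume "i \<in> {..<q\<^sup>2}" "j \<in> {..<q\<^sup>2}" "i \<noteq> j"
  then have ij: "i < q\<^sup>2" "j < q\<^sup>2" "i \<noteq> j" by auto
  obtain c where c: "c < q + 1" "A i c = A j c" and
    c_unique: "\<And>d. d < q + 1 \<Longrightarrow> A i d = A j d \<Longrightarrow> d = c"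
    using columns_agree_once[OF ij] by blast
  show "\<exists>!B. B \<in> {fibre c x | c x. c < q + 1 \<and> x \<in> X} \<and> i \<in> B \<and> j \<in> B"
  proof (rule ex1I[of _ "fibre c (A i c)"])
    show "fibre c (A i c) \<in> {fibre c x | c x. c < q + 1 \<and> x \<in> X} \<and>
        i \<in> fibre c (A i c) \<and> j \<in> fibre c (A i c)"
      using c ij entry[OF ij(1) c(1)] by (auto simp: fibre_def)
    fix B assume "B \<in> {fibre c x | c x. c < q + 1 \<and> x \<in> X} \<and> i \<in> B \<and> j \<in> B"
    then obtain d y where "B = fibre d y" "d < q + 1" "A i d = y" "A j d = y"
      by (auto simp: fibre_def)
    then show "B = fibre c (A i c)" using c_unique[of d] by auto
  qed
qed (use assms in auto)

text \<open>The numbers below \<open>q\<^sup>2\<close> are the rows, and \<open>q\<^sup>2 + c\<close> is the point at infinity of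
  column \<open>c\<close>.\<close>

definition projective_lines :: "nat set set" where
  "projective_lines =
     insert {q\<^sup>2..<q\<^sup>2 + q + 1} {insert (q\<^sup>2 + c) (fibre c x) | c x. c < q + 1 \<and> x \<in> X}"

lemma fibre_less: "i \<in> fibre c x \<Longrightarrow> i < q\<^sup>2"
  by (simp add: fibre_def)

lemma projective_join:
  assumes "a < b" "b < q\<^sup>2 + q + 1"
  shows "\<exists>!B. B \<in> projective_lines \<and> a \<in> B \<and> b \<in> B"
proof -
  consider (rows) "b < q\<^sup>2" | (mixed) "a < q\<^sup>2" "q\<^sup>2 \<le> b" | (inf) "q\<^sup>2 \<le> a" by linarith
  then show ?thesis
  proof cases
    case rows
    then have ij: "a < q\<^sup>2" "b < q\<^sup>2" "a \<noteq> b" using assms by auto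
    obtain c where c: "c < q + 1" "A a c = A b c" and
      c_unique: "\<And>d. d < q + 1 \<Longrightarrow> A a d = A b d \<Longrightarrow> d = c"
      using columns_agree_once[OF ij] by blast
    show ?thesis
    proof (rule ex1I[of _ "insert (q\<^sup>2 + c) (fibre c (A a c))"])
      show "insert (q\<^sup>2 + c) (fibre c (A a c)) \<in> projective_lines \<and>
          a \<in> insert (q\<^sup>2 + c) (fibre c (A a c)) \<and> b \<in> insert (q\<^sup>2 + c) (fibre c (A a c))"
        using c ij entry[OF ij(1) c(1)] by (auto simp: projective_lines_def fibre_def)
      fix B assume "B \<in> projective_lines \<and> a \<in> B \<and> b \<in> B"
      then obtain d y where "B = insert (q\<^sup>2 + d) (fibre d y)" "d < q + 1" "A a d = y" "A b d = y"
        using ij by (auto simp: projective_lines_def fibre_def)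
      then show "B = insert (q\<^sup>2 + c) (fibre c (A a c))" using c_unique[of d] by auto
    qed
  next
    case mixed
    define c where "c = b - q\<^sup>2"
    have c: "b = q\<^sup>2 + c" "c < q + 1" using mixed assms by (auto simp: c_def)
    show ?thesis
    proof (rule ex1I[of _ "insert (q\<^sup>2 + c) (fibre c (A a c))"])
      show "insert (q\<^sup>2 + c) (fibre c (A a c)) \<in> projective_lines \<and>
          a \<in> insert (q\<^sup>2 + c) (fibre c (A a c)) \<and> b \<in> insert (q\<^sup>2 + c) (fibre c (A a c))"
        using c mixed entry[OF mixed(1) c(2)] by (auto simp: projective_lines_def fibre_def)
      fix B assume "B \<in> projective_lines \<and> a \<in> B \<and> b \<in> B"
      then show "B = insert (q\<^sup>2 + c) (fibre c (A a c))"
        using mixed c by (auto simp: projective_lines_def fibre_def)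
    qed
  next
    case inf
    show ?thesis
    proof (rule ex1I[of _ "{q\<^sup>2..<q\<^sup>2 + q + 1}"])
      show "{q\<^sup>2..<q\<^sup>2 + q + 1} \<in> projective_lines \<and> a \<in> {q\<^sup>2..<q\<^sup>2 + q + 1} \<and> b \<in> {q\<^sup>2..<q\<^sup>2 + q + 1}"
        using assms inf by (auto simp: projective_lines_def)
      fix B assume "B \<in> projective_lines \<and> a \<in> B \<and> b \<in> B"
      then show "B = {q\<^sup>2..<q\<^sup>2 + q + 1}"
        using inf assms by (auto simp: projective_lines_def fibre_def)
    qed
  qed
qed

lemma weak_plane_of_array: "weak_plane {..<q\<^sup>2 + q + 1} projective_lines q"
proof (intro weak_plane.intro linear_space.intro weak_plane_axioms.intro)
  fix B assume "B \<in> projective_lines"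
  then consider (inf) "B = {q\<^sup>2..<q\<^sup>2 + q + 1}"
    | (fin) c x where "B = insert (q\<^sup>2 + c) (fibre c x)" "c < q + 1" "x \<in> X"
    by (auto simp: projective_lines_def)
  then have "B \<subseteq> {..<q\<^sup>2 + q + 1} \<and> card B = q + 1"
  proof cases
    case inf
    then show ?thesis by auto
  next
    case (fin c x)
    have "q\<^sup>2 + c \<notin> fibre c x" using fibre_less by fastforce
    then have "card B = q + 1" using fin card_fibre finite_fibre by simp
    moreover have "fibre c x \<subseteq> {..<q\<^sup>2 + q + 1}" using fibre_less by fastforce
    ultimately show ?thesis using fin by simp
  qed
  then show "B \<subseteq> {..<q\<^sup>2 + q + 1}" "card B = q + 1" by auto
next
  fix a b assume "a \<in> {..<q\<^sup>2 + q + 1}" "b \<in> {..<q\<^sup>2 + q + 1}" "a \<noteq> b"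
  then show "\<exists>!B. B \<in> projective_lines \<and> a \<in> B \<and> b \<in> B"
    using projective_join[of a b] projective_join[of b a]
    by (cases a b rule: linorder_cases) (auto simp: conj_commute)
qed (use q_pos in auto)

end

lemma weak_plane_iff_orthogonal_array:
  "(\<exists>(X :: nat set) \<B>. weak_plane X \<B> q) \<longleftrightarrow> orthogonal_array_exists (q + 1) q"
proof
  assume "orthogonal_array_exists (q + 1) q"
  then obtain X :: "nat set" and A where "orthogonal_array (q + 1) q X A"
    by (auto simp: orthogonal_array_exists_def)
  then have "full_array X A q" by (simp add: full_array_def array_def)
  then show "\<exists>(X :: nat set) \<B>. weak_plane X \<B> q" using full_array.weak_plane_of_array by blast
next
  assume "\<exists>(X :: nat set) \<B>. weak_plane X \<B> q"
  then show "orthogonal_array_exists (q + 1) q" using weak_plane.orthogonal_array_of_plane by blast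
qed

lemma affine_plane_iff_orthogonal_array:
  assumes "q \<noteq> 1"
  shows "affine_plane_exists q \<longleftrightarrow> orthogonal_array_exists (q + 1) q"
proof
  assume "orthogonal_array_exists (q + 1) q"
  then obtain X :: "nat set" and A where "orthogonal_array (q + 1) q X A"
    by (auto simp: orthogonal_array_exists_def)
  then interpret full_array X A q by (simp add: full_array_def array_def)
  have "2 \<le> q" using q_pos assms by simp
  then show "affine_plane_exists q"
    unfolding affine_plane_exists_def using affine_plane_if_affine_space[OF affine_space_of_array] by blast
qed (rule orthogonal_array_exists_if_affine_plane_exists)

section \<open>Latin squares\<close>

text \<open>The rows of the array are the cells; the first two columns contain the coordinates, and each
  further column contains the entries of one square. The squares must first be relabelled to a
  common set of symbols. The Latin property of a square says that its column is compatible with the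
  two coordinate columns.\<close>

lemma orthogonal_array_if_mols:
  fixes X :: "nat \<Rightarrow> 'a set"
  assumes "mols m q X L"
  shows "orthogonal_array_exists (m + 2) q"
proof -
  have q: "1 \<le> q" using assms by (simp add: mols_def)
  have "\<exists>h. bij_betw h (X s) {..<q}" if "s < m" for s
    using assms that ex_bij_betw_finite_nat[of "X s"]
    by (auto simp: mols_def latin_square_def atLeast0LessThan)
  then obtain g where g: "\<And>s. s < m \<Longrightarrow> bij_betw (g s) (X s) {..<q}" by metis
  define M where "M s i j = g s (L s i j)" for s i j
  have row: "bij_betw (M s i) {..<q} {..<q}" if "s < m" "i < q" for s i
  proof -
    have "bij_betw (L s i) {..<q} (X s)"
      using assms that by (simp add: mols_def latin_square_def)
    then have "bij_betw (g s \<circ> L s i) {..<q} {..<q}" using g[OF that(1)] by (rule bij_betw_trans)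
    then show ?thesis by (simp add: M_def[abs_def] comp_def)
  qed
  have col: "bij_betw (\<lambda>i. M s i j) {..<q} {..<q}" if "s < m" "j < q" for s j
  proof -
    have "bij_betw (\<lambda>i. L s i j) {..<q} (X s)"
      using assms that by (simp add: mols_def latin_square_def)
    then have "bij_betw (g s \<circ> (\<lambda>i. L s i j)) {..<q} {..<q}" using g[OF that(1)]
      by (rule bij_betw_trans)
    then show ?thesis by (simp add: M_def[abs_def] comp_def)
  qed
  have orth: "\<exists>!p. p \<in> {..<q} \<times> {..<q} \<and> M s (fst p) (snd p) = x \<and> M t (fst p) (snd p) = y"
    if st: "s < m" "t < m" "s \<noteq> t" and xy: "x < q" "y < q" for s t x y
  proof -
    have L_in: "L s i j \<in> X s" if "s < m" "i < q" "j < q" for s i j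
      using assms that bij_betw_apply[of "L s i" "{..<q}" "X s" j]
      by (simp add: mols_def latin_square_def)
    have relabel: "\<exists>x'\<in>X s. \<forall>v\<in>X s. g s v = x \<longleftrightarrow> v = x'" if "s < m" "x < q" for s x
      using g[OF that(1)] that(2) unfolding bij_betw_def inj_on_def by (metis imageE lessThan_iff)
    obtain x' where x': "x' \<in> X s" "\<And>v. v \<in> X s \<Longrightarrow> g s v = x \<longleftrightarrow> v = x'"
      using relabel[OF st(1) xy(1)] by blast
    obtain y' where y': "y' \<in> X t" "\<And>v. v \<in> X t \<Longrightarrow> g t v = y \<longleftrightarrow> v = y'"
      using relabel[OF st(2) xy(2)] by blast
    have "\<exists>!(i, j). i < q \<and> j < q \<and> L s i j = x' \<and> L t i j = y'"
      using assms st x'(1) y'(1) unfolding mols_def orthogonal_squares_def by blast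
    moreover have "(\<lambda>(i, j). i < q \<and> j < q \<and> L s i j = x' \<and> L t i j = y') =
        (\<lambda>p. p \<in> {..<q} \<times> {..<q} \<and> M s (fst p) (snd p) = x \<and> M t (fst p) (snd p) = y)"
    proof
      fix p
      show "(case p of (i, j) \<Rightarrow> i < q \<and> j < q \<and> L s i j = x' \<and> L t i j = y') =
          (p \<in> {..<q} \<times> {..<q} \<and> M s (fst p) (snd p) = x \<and> M t (fst p) (snd p) = y)"
      proof (cases "p \<in> {..<q} \<times> {..<q}")
        case True
        then have "L s (fst p) (snd p) \<in> X s" "L t (fst p) (snd p) \<in> X t" using L_in st by auto
        then show ?thesis using x'(2) y'(2) True by (auto simp: M_def)
      qed auto
    qed
    ultimately show ?thesis by (simp only:)
  qed
  define f where
    "f c p = (if c = 0 then fst p else if c = 1 then snd p else M (c - 2) (fst p) (snd p))"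
    for c and p :: "nat \<times> nat"
  have unique: "\<exists>!p. p \<in> {..<q} \<times> {..<q} \<and> f c p = x \<and> f d p = y"
    if cd: "c < d" "d < m + 2" and xy: "x < q" "y < q" for c d x y
  proof -
    consider "c = 0" "d = 1" | s where "c = 0" "d = s + 2" | s where "c = 1" "d = s + 2"
      | s t where "c = s + 2" "d = t + 2"
    proof -
      have "d = 1 \<or> (\<exists>s. d = s + 2)" "c = 0 \<or> c = 1 \<or> (\<exists>s. c = s + 2)"
        using cd by presburger+
      then show ?thesis using that cd by fastforce
    qed
    then show ?thesis
    proof cases
      case 1
      then show ?thesis using xy by (intro ex1I[of _ "(x, y)"]) (auto simp: f_def)
    next
      case (2 s)
      then have s: "s < m" using cd by simp
      obtain j where j: "j < q" "M s x j = y"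
        using row[OF s xy(1)] xy(2) by (metis bij_betw_imp_surj_on imageE lessThan_iff)
      show ?thesis
        using 2 j xy inj_onD[OF bij_betw_imp_inj_on[OF row[OF s xy(1)]]]
        by (intro ex1I[of _ "(x, j)"]) (auto simp: f_def)
    next
      case (3 s)
      then have s: "s < m" using cd by simp
      obtain i where i: "i < q" "M s i x = y"
        using col[OF s xy(1)] xy(2) by (metis bij_betw_imp_surj_on imageE lessThan_iff)
      show ?thesis
        using 3 i xy inj_onD[OF bij_betw_imp_inj_on[OF col[OF s xy(1)]]]
        by (intro ex1I[of _ "(i, x)"]) (auto simp: f_def)
    next
      case (4 s t)
      then show ?thesis using orth[of s t x y] cd xy by (simp add: f_def)
    qed
  qed
  show ?thesis
  proof (rule orthogonal_array_existsI[of _ _ "{..<q} \<times> {..<q}" "\<lambda>_. {..<q}" f])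
    show "f c p \<in> {..<q}" if "c < m + 2" "p \<in> {..<q} \<times> {..<q}" for c p
    proof -
      have "M (c - 2) (fst p) (snd p) \<in> {..<q}" if "2 \<le> c"
        using bij_betw_apply[OF row[of "c - 2" "fst p"], of "snd p"] \<open>c < m + 2\<close>
          \<open>p \<in> {..<q} \<times> {..<q}\<close> that by auto
      then show ?thesis using that by (auto simp: f_def)
    qed
    show "\<exists>!p. p \<in> {..<q} \<times> {..<q} \<and> f c p = x \<and> f d p = y"
      if "c < m + 2" "d < m + 2" "c \<noteq> d" "x \<in> {..<q}" "y \<in> {..<q}" for c d x y
    proof (cases "c < d")
      case True
      then show ?thesis using unique[of c d x y] that by simp
    next
      case False
      then show ?thesis using unique[of d c y x] that by (simp add: conj_commute)
    qed
  qed (use q in \<open>auto simp: power2_eq_square\<close>)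
qed

text \<open>\<open>r i j\<close> is the row whose first two entries are the symbols with numbers \<open>i\<close> and \<open>j\<close>; it
  locates the row in the cell \<open>(i, j)\<close>.\<close>

lemma (in array) mols:
  "\<exists>L. mols (s - 2) q (\<lambda>_. X) L"
proof -
  obtain e where e: "bij_betw e {..<q} X"
    using ex_bij_betw_nat_finite[OF finite_X] card_X by (auto simp: atLeast0LessThan)
  have e_in: "e i \<in> X" if "i < q" for i using bij_betw_apply[OF e] that by simp
  have e_inj: "i = j" if "e i = e j" "i < q" "j < q" for i j
    using inj_onD[OF bij_betw_imp_inj_on[OF e] that(1)] that by simp
  have e_surj: "\<exists>i<q. e i = x" if "x \<in> X" for x
    using e that by (metis bij_betw_imp_surj_on imageE lessThan_iff)
  have col01: "0 < s" "1 < s" using s_ge_2 by auto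
  define r where "r i j = (THE k. k < q\<^sup>2 \<and> A k 0 = e i \<and> A k 1 = e j)" for i j
  have r: "r i j < q\<^sup>2" "A (r i j) 0 = e i" "A (r i j) 1 = e j" if "i < q" "j < q" for i j
    using theI'[OF unique_row[OF col01 _ e_in[OF that(1)] e_in[OF that(2)]]]
    unfolding r_def by auto
  have r_surj: "\<exists>i<q. \<exists>j<q. k = r i j \<and> A k 0 = e i \<and> A k 1 = e j" if k: "k < q\<^sup>2" for k
  proof -
    obtain i j where ij: "i < q" "j < q" "e i = A k 0" "e j = A k 1"
      using e_surj entry[OF k] col01 by metis
    then have "k = r i j" using row_eqI[OF col01 _ k] r[OF ij(1,2)] by simp
    then show ?thesis using ij by metis
  qed
  define L where "L t i j = A (r i j) (t + 2)" for t i j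
  have lt: "t + 2 < s" if "t < s - 2" for t using that by simp
  have "latin_square q X (L t)" if "t < s - 2" for t
    unfolding latin_square_def
  proof (intro conjI allI impI)
    note t = lt[OF that]
    show "bij_betw (\<lambda>j. L t i j) {..<q} X" if i: "i < q" for i
    proof (intro bij_betw_imageI inj_onI equalityI subsetI)
      fix j j' assume j: "j \<in> {..<q}" "j' \<in> {..<q}" "L t i j = L t i j'"
      then have "r i j = r i j'"
        using row_eqI[OF col01(1) t] r[of i j] r[of i j'] i by (simp add: L_def)
      then show "j = j'" using r(3)[of i j] r(3)[of i j'] e_inj i j by simp
    next
      fix x assume x: "x \<in> X"
      obtain k where k: "k < q\<^sup>2" "A k 0 = e i" "A k (t + 2) = x"
        using unique_row[OF col01(1) t _ e_in[OF i] x] by auto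
      then obtain i' j where "i' < q" "j < q" "k = r i' j" "A k 0 = e i'" using r_surj by blast
      then show "x \<in> L t i ` {..<q}" using e_inj[of i i'] k i by (auto simp: L_def)
    qed (use r(1) entry t i in \<open>auto simp: L_def\<close>)
    show "bij_betw (\<lambda>i. L t i j) {..<q} X" if j: "j < q" for j
    proof (intro bij_betw_imageI inj_onI equalityI subsetI)
      fix i i' assume i: "i \<in> {..<q}" "i' \<in> {..<q}" "L t i j = L t i' j"
      then have "r i j = r i' j"
        using row_eqI[OF col01(2) t] r[of i j] r[of i' j] j by (simp add: L_def)
      then show "i = i'" using r(2)[of i j] r(2)[of i' j] e_inj i j by simp
    next
      fix x assume x: "x \<in> X"
      obtain k where k: "k < q\<^sup>2" "A k 1 = e j" "A k (t + 2) = x"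
        using unique_row[OF col01(2) t _ e_in[OF j] x] by auto
      then obtain i j' where "i < q" "j' < q" "k = r i j'" "A k 1 = e j'" using r_surj by blast
      then show "x \<in> (\<lambda>i. L t i j) ` {..<q}" using e_inj[of j j'] k j by (auto simp: L_def)
    qed (use r(1) entry t j in \<open>auto simp: L_def\<close>)
  qed (use q_pos finite_X card_X in auto)
  moreover have "orthogonal_squares q X (L t) X (L u)" if tu: "t < s - 2" "u < s - 2" "t \<noteq> u" for t u
    unfolding orthogonal_squares_def
  proof (intro ballI)
    fix x y assume xy: "x \<in> X" "y \<in> X"
    have "t + 2 \<noteq> u + 2" using tu(3) by simp
    then have ex1: "\<exists>!k. k < q\<^sup>2 \<and> A k (t + 2) = x \<and> A k (u + 2) = y"
      by (rule unique_row[OF lt[OF tu(1)] lt[OF tu(2)] _ xy])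
    then obtain k where k: "k < q\<^sup>2" "A k (t + 2) = x" "A k (u + 2) = y" by auto
    have k_unique: "k' = k" if "k' < q\<^sup>2" "A k' (t + 2) = x" "A k' (u + 2) = y" for k'
      using ex1 k that by auto
    obtain i j where ij: "i < q" "j < q" "k = r i j" using r_surj[OF k(1)] by blast
    have ij_unique: "i' = i \<and> j' = j" if "i' < q" "j' < q" "L t i' j' = x" "L u i' j' = y" for i' j'
    proof -
      have "r i' j' = r i j" using k_unique[of "r i' j'"] r(1) that ij by (simp add: L_def)
      then have "e i' = e i" "e j' = e j" using r(2,3)[of i' j'] r(2,3)[of i j] that ij by auto
      then show ?thesis using that ij e_inj by blast
    qed
    show "\<exists>!(i, j). i < q \<and> j < q \<and> L t i j = x \<and> L u i j = y"
    proof (rule ex1I[of _ "(i, j)"])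
      show "case (i, j) of (i, j) \<Rightarrow> i < q \<and> j < q \<and> L t i j = x \<and> L u i j = y"
        using ij k by (simp add: L_def)
    next
      fix p assume "case p of (i, j) \<Rightarrow> i < q \<and> j < q \<and> L t i j = x \<and> L u i j = y"
      then show "p = (i, j)" using ij_unique[of "fst p" "snd p"] by (cases p) simp
    qed
  qed
  ultimately have "mols (s - 2) q (\<lambda>_. X) L" using q_pos by (simp add: mols_def)
  then show ?thesis by blast
qed

lemma mols_iff_orthogonal_array:
  "mols_exist m q \<longleftrightarrow> orthogonal_array_exists (m + 2) q"
proof
  assume "orthogonal_array_exists (m + 2) q"
  then obtain X :: "nat set" and A where "orthogonal_array (m + 2) q X A"
    by (auto simp: orthogonal_array_exists_def)
  then interpret array X A "m + 2" q by (rule array.intro)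
  show "mols_exist m q" using mols unfolding mols_exist_def by auto
next
  assume "mols_exist m q"
  then obtain X :: "nat \<Rightarrow> nat set" and L where "mols m q X L"
    by (auto simp: mols_exist_def)
  then show "orthogonal_array_exists (m + 2) q" by (rule orthogonal_array_if_mols)
qed

section \<open>Legal sequences and total dominating sets\<close>

locale isolate_free_graph = pair_graph G for G :: "'a pair_pre_digraph" +
  assumes no_isolated: "no_isolated_vertices G"
begin

lemma nbhd_sym: "u \<in> nbhd G v \<longleftrightarrow> v \<in> nbhd G u"
  using pair_sym_arcs by (auto simp: nbhd_def symmetric_def sym_def)

lemma nbhd_verts: "u \<in> nbhd G v \<Longrightarrow> u \<in> pverts G"
  using in_arcsD2 by (auto simp: nbhd_def)

lemma finite_nbhd: "finite (nbhd G v)"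
  using nbhd_verts pair_finite_verts by (meson finite_subset subsetI)

lemma nbhd_nonempty: "v \<in> pverts G \<Longrightarrow> nbhd G v \<noteq> {}"
  using no_isolated by (auto simp: no_isolated_vertices_def)

lemma legal_Nil: "legal G []"
  by (simp add: legal_def)

text \<open>In the absence of isolated vertices the condition on new neighbours may also be imposed on the
  first term, and it implies distinctness.\<close>

lemma legal_snoc:
  "legal G (vs @ [u]) \<longleftrightarrow>
     legal G vs \<and> u \<in> pverts G \<and> (\<exists>w\<in>nbhd G u. \<forall>v\<in>set vs. w \<notin> nbhd G v)"
proof -
  have Un: "(\<Union>j<length vs. nbhd G (vs ! j)) = (\<Union>v\<in>set vs. nbhd G v)"
    by (auto simp: set_conv_nth)
  have init: "(\<Union>j<i. nbhd G ((vs @ [u]) ! j)) = (\<Union>j<i. nbhd G (vs ! j))"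
    if "i \<le> length vs" for i
    using that by (intro SUP_cong) (auto simp: nth_append)
  have "(\<forall>i\<in>{1..<length (vs @ [u])}. nbhd G ((vs @ [u]) ! i) - (\<Union>j<i. nbhd G ((vs @ [u]) ! j)) \<noteq> {})
    \<longleftrightarrow> (\<forall>i\<in>{1..<length vs}. nbhd G (vs ! i) - (\<Union>j<i. nbhd G (vs ! j)) \<noteq> {}) \<and>
      (vs \<noteq> [] \<longrightarrow> nbhd G u - (\<Union>v\<in>set vs. nbhd G v) \<noteq> {})" (is "?L \<longleftrightarrow> ?R")
  proof -
    have "?L \<longleftrightarrow> (\<forall>i\<in>{1..<Suc (length vs)}.
        nbhd G ((vs @ [u]) ! i) - (\<Union>j<i. nbhd G (vs ! j)) \<noteq> {})"
      using init by (intro ball_cong) auto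
    also have "\<dots> \<longleftrightarrow> ?R"
      unfolding Un[symmetric] by (cases "vs = []") (auto simp: nth_append atLeastLessThanSuc Suc_le_eq)
    finally show ?thesis .
  qed
  then have "legal G (vs @ [u]) \<longleftrightarrow> legal G vs \<and> u \<in> pverts G \<and> u \<notin> set vs \<and>
      (vs \<noteq> [] \<longrightarrow> nbhd G u - (\<Union>v\<in>set vs. nbhd G v) \<noteq> {})"
    unfolding legal_def by auto
  then show ?thesis using nbhd_nonempty[of u] by (cases "vs = []") auto
qed

lemma legal_appendD: "legal G (us @ ws) \<Longrightarrow> legal G us"
proof (induction ws rule: rev_induct)
  case (snoc w ws)
  then show ?case using legal_snoc[of "us @ ws" w] by simp
qed simp

lemma legal_filter: "legal G vs \<Longrightarrow> legal G (filter P vs)"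
  by (induction vs rule: rev_induct) (auto simp: legal_snoc legal_Nil)

lemma legal_length: "legal G vs \<Longrightarrow> length vs \<le> card (pverts G)"
  using pair_finite_verts by (auto simp: legal_def intro!: card_mono simp flip: distinct_card)

text \<open>While some vertex \<open>v\<close> is undominated, any neighbour of \<open>v\<close> can be appended.\<close>

lemma legal_extends:
  assumes "legal G us"
  shows "\<exists>ws. total_dominating_sequence G (us @ ws)"
  using assms
proof (induction "card (pverts G) - length us" arbitrary: us rule: less_induct)
  case less
  show ?case
  proof (cases "total_dominating_set G (set us)")
    case True
    then have "total_dominating_sequence G (us @ [])"
      using less.prems by (simp add: total_dominating_sequence_def)
    then show ?thesis by blast
  next
    case False
    then obtain v where v: "v \<in> pverts G" "nbhd G v \<inter> set us = {}"
      using less.prems by (auto simp: total_dominating_set_def legal_def)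
    then obtain u where u: "u \<in> nbhd G v" using nbhd_nonempty by blast
    have "legal G (us @ [u])"
      unfolding legal_snoc using less.prems u v nbhd_verts nbhd_sym by blast
    moreover from this have "card (pverts G) - length (us @ [u]) < card (pverts G) - length us"
      using legal_length by fastforce
    ultimately obtain ws where "total_dominating_sequence G ((us @ [u]) @ ws)"
      using less.hyps by blast
    then show ?thesis by auto
  qed
qed

text \<open>If both numbers are \<open>m\<close>, then every legal sequence is bounded by \<open>m\<close>, since it is a prefix of a
  total dominating sequence. In the other direction, the two bounds force every total dominating
  sequence to have length \<open>m\<close>.\<close>

lemma both_numbers_eq_iff:
  "total_domination_number G = m \<and> grundy_total_domination_number G = m \<longleftrightarrow>
     (\<forall>S. total_dominating_set G S \<longrightarrow> m \<le> card S) \<and> (\<forall>vs. legal G vs \<longrightarrow> length vs \<le> m)"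
proof -
  let ?D = "{card S | S. total_dominating_set G S}"
  let ?L = "{length vs | vs. total_dominating_sequence G vs}"
  have "?D \<subseteq> {..card (pverts G)}"
    using card_mono[OF pair_finite_verts] by (auto simp: total_dominating_set_def)
  then have finD: "finite ?D" using finite_subset by blast
  have "?L \<subseteq> {..card (pverts G)}"
    using legal_length by (auto simp: total_dominating_sequence_def)
  then have finL: "finite ?L" using finite_subset by blast
  have seq_in_D: "length vs \<in> ?D" if "total_dominating_sequence G vs" for vs
  proof -
    have "total_dominating_set G (set vs)" "card (set vs) = length vs"
      using that by (auto simp: total_dominating_sequence_def legal_def distinct_card)
    then show ?thesis by force
  qed
  obtain vs where vs: "total_dominating_sequence G vs" using legal_extends[OF legal_Nil] by auto
  show ?thesis
  proof (intro iffI conjI allI impI; (elim conjE)?)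
    assume min: "total_domination_number G = m"
    show "m \<le> card S" if "total_dominating_set G S" for S
      using Min_le[OF finD, of "card S"] that min by (auto simp: total_domination_number_def)
  next
    fix us assume max: "grundy_total_domination_number G = m" and "legal G us"
    then obtain ws where "total_dominating_sequence G (us @ ws)" using legal_extends by blast
    then have "length (us @ ws) \<le> m"
      using Max_ge[OF finL, of "length (us @ ws)"] max
      unfolding grundy_total_domination_number_def by blast
    then show "length us \<le> m" by simp
  next
    assume min: "\<forall>S. total_dominating_set G S \<longrightarrow> m \<le> card S"
      and max: "\<forall>vs. legal G vs \<longrightarrow> length vs \<le> m"
    have len: "length us = m" if "total_dominating_sequence G us" for us
    proof -
      have "m \<le> length us" using seq_in_D[OF that] min by force
      moreover have "length us \<le> m" using max that by (simp add: total_dominating_sequence_def)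
      ultimately show ?thesis by simp
    qed
    have "m \<in> ?D" using seq_in_D[OF vs] len[OF vs] by simp
    then show "total_domination_number G = m"
      unfolding total_domination_number_def using min finD by (intro Min_eqI) auto
    have "?L = {m}" using len vs by auto
    then show "grundy_total_domination_number G = m"
      unfolding grundy_total_domination_number_def by simp
  qed
qed

end

section \<open>Bipartite graphs\<close>

locale bipartite_graph = isolate_free_graph G for G :: "'a pair_pre_digraph" +
  fixes A B :: "'a set"
  assumes parts: "A \<union> B = pverts G" "A \<inter> B = {}"
    and crossing: "(u, v) \<in> parcs G \<Longrightarrow> u \<in> A \<and> v \<in> B \<or> u \<in> B \<and> v \<in> A"
begin

lemma swap: "bipartite_graph G B A"
  using parts crossing by unfold_locales auto

lemma nbhd_side: "b \<in> B \<Longrightarrow> nbhd G b \<subseteq> A" "a \<in> A \<Longrightarrow> nbhd G a \<subseteq> B"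
  using parts crossing by (auto simp: nbhd_def)

lemma finite_sides: "finite A" "finite B"
  using pair_finite_verts by (simp_all flip: parts)

text \<open>Going back from \<open>a4\<close> to \<open>a1\<close>, the vertex \<open>a\<^sub>i\<close> newly dominates \<open>b\<^sub>i\<close>, because
  \<open>a\<^sub>j \<notin> N(b\<^sub>i)\<close> for \<open>j > i\<close>. So \<open>b1, b2, b3, b4, a4, a3, a2, a1\<close> is legal.\<close>

lemma no_legal_four:
  assumes "\<forall>vs. legal G vs \<longrightarrow> length vs \<le> 6"
    and "b1 \<in> B" "b2 \<in> B" "b3 \<in> B" "b4 \<in> B"
    and "a1 \<in> nbhd G b1"
    and "a2 \<in> nbhd G b2" "a2 \<notin> nbhd G b1"
    and "a3 \<in> nbhd G b3" "a3 \<notin> nbhd G b2" "a3 \<notin> nbhd G b1"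
    and "a4 \<in> nbhd G b4" "a4 \<notin> nbhd G b3" "a4 \<notin> nbhd G b2" "a4 \<notin> nbhd G b1"
  shows False
proof -
  have "legal G (((((((([] @ [b1]) @ [b2]) @ [b3]) @ [b4]) @ [a4]) @ [a3]) @ [a2]) @ [a1])"
  proof -
    have side: "b \<notin> nbhd G b'" if "b \<in> B" "b' \<in> B" for b b'
      using nbhd_side that parts by blast
    have V: "b1 \<in> pverts G" "b2 \<in> pverts G" "b3 \<in> pverts G" "b4 \<in> pverts G"
        "a1 \<in> pverts G" "a2 \<in> pverts G" "a3 \<in> pverts G" "a4 \<in> pverts G"
      using assms parts nbhd_verts by auto
    have 4: "legal G (((([] @ [b1]) @ [b2]) @ [b3]) @ [b4])"
      unfolding legal_snoc using assms V legal_Nil by auto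
    have 5: "\<exists>w\<in>nbhd G a4. \<forall>v\<in>set (((([] @ [b1]) @ [b2]) @ [b3]) @ [b4]). w \<notin> nbhd G v"
      using assms side nbhd_sym by (intro bexI[of _ b4]) auto
    have 6: "\<exists>w\<in>nbhd G a3. \<forall>v\<in>set ((((([] @ [b1]) @ [b2]) @ [b3]) @ [b4]) @ [a4]). w \<notin> nbhd G v"
      using assms side nbhd_sym by (intro bexI[of _ b3]) auto
    have 7: "\<exists>w\<in>nbhd G a2. \<forall>v\<in>set (((((([] @ [b1]) @ [b2]) @ [b3]) @ [b4]) @ [a4]) @ [a3]).
        w \<notin> nbhd G v"
      using assms side nbhd_sym by (intro bexI[of _ b2]) auto
    have 8: "\<exists>w\<in>nbhd G a1. \<forall>v\<in>set ((((((([] @ [b1]) @ [b2]) @ [b3]) @ [b4]) @ [a4]) @ [a3]) @ [a2]).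
        w \<notin> nbhd G v"
      using assms side nbhd_sym by (intro bexI[of _ b1]) auto
    show ?thesis by (intro iffD2[OF legal_snoc] conjI 4 5 6 7 8 V)
  qed
  then show False using assms(1) by fastforce
qed

text \<open>Otherwise \<open>b1, b2\<close> dominate \<open>A\<close>. A total dominating sequence that starts with them has at
  least four more terms, and these lie in \<open>A\<close>, as vertices of \<open>B\<close> have nothing new to dominate;
  this contradicts \<open>no_legal_four\<close> with the sides exchanged.\<close>

lemma common_nonneighbour:
  assumes tds: "\<forall>S. total_dominating_set G S \<longrightarrow> 6 \<le> card S"
    and legal: "\<forall>vs. legal G vs \<longrightarrow> length vs \<le> 6"
    and b: "b1 \<in> B" "b2 \<in> B" "\<not> nbhd G b2 \<subseteq> nbhd G b1"
  shows "\<exists>a\<in>A. a \<notin> nbhd G b1 \<and> a \<notin> nbhd G b2"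
proof (rule ccontr)
  assume "\<not> ?thesis"
  then have dom: "a \<in> nbhd G b1 \<or> a \<in> nbhd G b2" if "a \<in> A" for a using that by auto
  have V: "b1 \<in> pverts G" "b2 \<in> pverts G" using b parts by auto
  have "legal G (([] @ [b1]) @ [b2])"
    unfolding legal_snoc using b V legal_Nil nbhd_nonempty by auto
  then obtain ws where ws: "total_dominating_sequence G ([b1, b2] @ ws)"
    using legal_extends by fastforce
  then have "6 \<le> card (set ([b1, b2] @ ws))"
    using tds unfolding total_dominating_sequence_def by blast
  then have "6 \<le> length ([b1, b2] @ ws)" using card_length order_trans by blast
  then have "4 \<le> length ws" by simp
  then obtain w1 w2 w3 w4 ws' where "ws = w1 # w2 # w3 # w4 # ws'"
    by (auto simp: Suc_le_length_iff numeral_eq_Suc)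
  then have "legal G (((((([] @ [b1]) @ [b2]) @ [w1]) @ [w2]) @ [w3]) @ [w4])"
    using ws legal_appendD[of "[b1, b2, w1, w2, w3, w4]" ws']
    by (simp add: total_dominating_sequence_def)
  then have w: "w1 \<in> pverts G" "w2 \<in> pverts G" "w3 \<in> pverts G" "w4 \<in> pverts G"
    and "\<exists>x\<in>nbhd G w1. x \<notin> nbhd G b1 \<and> x \<notin> nbhd G b2"
      "\<exists>x\<in>nbhd G w2. x \<notin> nbhd G b1 \<and> x \<notin> nbhd G b2 \<and> x \<notin> nbhd G w1"
      "\<exists>x\<in>nbhd G w3. x \<notin> nbhd G b1 \<and> x \<notin> nbhd G b2 \<and> x \<notin> nbhd G w1 \<and> x \<notin> nbhd G w2"
      "\<exists>x\<in>nbhd G w4. x \<notin> nbhd G b1 \<and> x \<notin> nbhd G b2 \<and>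
        x \<notin> nbhd G w1 \<and> x \<notin> nbhd G w2 \<and> x \<notin> nbhd G w3"
    unfolding legal_snoc by simp_all
  then obtain x1 x2 x3 x4 where
    x: "x1 \<in> nbhd G w1" "x1 \<notin> nbhd G b1" "x1 \<notin> nbhd G b2"
      "x2 \<in> nbhd G w2" "x2 \<notin> nbhd G b1" "x2 \<notin> nbhd G b2" "x2 \<notin> nbhd G w1"
      "x3 \<in> nbhd G w3" "x3 \<notin> nbhd G b1" "x3 \<notin> nbhd G b2" "x3 \<notin> nbhd G w1" "x3 \<notin> nbhd G w2"
      "x4 \<in> nbhd G w4" "x4 \<notin> nbhd G b1" "x4 \<notin> nbhd G b2" "x4 \<notin> nbhd G w1" "x4 \<notin> nbhd G w2"
      "x4 \<notin> nbhd G w3"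
    by blast
  have inA: "v \<in> A" if "v \<in> pverts G" "x \<in> nbhd G v" "x \<notin> nbhd G b1" "x \<notin> nbhd G b2" for v x
    using that dom[of x] nbhd_side(1)[of v] parts(1) by auto
  show False
    by (rule bipartite_graph.no_legal_four[OF swap legal, of w1 w2 w3 w4 x1 x2 x3 x4])
      (fact x inA[OF w(1) x(1-3)] inA[OF w(2) x(4-6)] inA[OF w(3) x(8-10)] inA[OF w(4) x(13-15)])+
qed

text \<open>The complements \<open>A - N(b)\<close> of the neighbourhoods, regarded as lines, meet pairwise in exactly
  one point.\<close>

definition meets_once :: bool where
  "meets_once \<longleftrightarrow> (\<forall>b\<in>B. \<forall>b'\<in>B. b \<noteq> b' \<longrightarrow> (\<exists>!a. a \<in> A \<and> a \<notin> nbhd G b \<and> a \<notin> nbhd G b'))"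

text \<open>If \<open>a\<close> and \<open>a'\<close> are distinct common non-neighbours of \<open>b1\<close> and \<open>b2\<close>, choose \<open>b3\<close> adjacent to
  \<open>a'\<close> but not to \<open>a\<close>, and then \<open>b4\<close> adjacent to \<open>a\<close>: four vertices of \<open>B\<close> that each dominate
  something new.\<close>

lemma meets_once_if_numbers_eq_6:
  assumes tds: "\<forall>S. total_dominating_set G S \<longrightarrow> 6 \<le> card S"
    and legal: "\<forall>vs. legal G vs \<longrightarrow> length vs \<le> 6"
    and incomparable: "\<And>u v. u \<in> pverts G \<Longrightarrow> v \<in> pverts G \<Longrightarrow> u \<noteq> v \<Longrightarrow> \<not> nbhd G u \<subseteq> nbhd G v"
  shows meets_once
  unfolding meets_once_def
proof (intro ballI impI)
  fix b1 b2 assume b: "b1 \<in> B" "b2 \<in> B" "b1 \<noteq> b2"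
  then have "\<not> nbhd G b2 \<subseteq> nbhd G b1" using incomparable[of b2 b1] parts by auto
  from common_nonneighbour[OF tds legal b(1,2) this]
  obtain a where a: "a \<in> A" "a \<notin> nbhd G b1" "a \<notin> nbhd G b2" by blast
  obtain x2 where x2: "x2 \<in> nbhd G b2" "x2 \<notin> nbhd G b1" using \<open>\<not> _ \<subseteq> _\<close> by blast
  obtain x1 where x1: "x1 \<in> nbhd G b1" using nbhd_nonempty[of b1] b parts by auto
  have "a' = a" if a': "a' \<in> A" "a' \<notin> nbhd G b1" "a' \<notin> nbhd G b2" for a'
  proof (rule ccontr)
    assume "a' \<noteq> a"
    then have "\<not> nbhd G a' \<subseteq> nbhd G a" using incomparable[of a' a] a a' parts by auto
    then obtain b3 where b3: "b3 \<in> nbhd G a'" "b3 \<notin> nbhd G a" by blast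
    obtain b4 where b4: "b4 \<in> nbhd G a" using nbhd_nonempty[of a] a parts by auto
    have "b3 \<in> B" "b4 \<in> B" using b3 b4 nbhd_side a a' by blast+
    then show False
      using no_legal_four[OF legal b(1,2), of b3 b4 x1 x2 a' a] a a' b3 b4 x1 x2 nbhd_sym by blast
  qed
  then show "\<exists>!a. a \<in> A \<and> a \<notin> nbhd G b1 \<and> a \<notin> nbhd G b2" using a by blast
qed

text \<open>Two vertices of \<open>B\<close> leave their common non-neighbour undominated.\<close>

lemma meets_once_dominators:
  assumes meets_once "2 \<le> card B" "\<And>a. a \<in> A \<Longrightarrow> nbhd G a \<inter> S \<noteq> {}" "S \<subseteq> pverts G"
  shows "3 \<le> card (S \<inter> B)"
proof (rule ccontr)
  assume "\<not> ?thesis"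
  then have "card (S \<inter> B) \<le> 2" by simp
  then obtain T where T: "S \<inter> B \<subseteq> T" "T \<subseteq> B" "card T = 2"
    using exists_subset_between[of "S \<inter> B" 2 B] assms(2) finite_sides by auto
  then obtain b b' where b: "T = {b, b'}" "b \<noteq> b'" by (meson card_2_iff)
  then have "b \<in> B" "b' \<in> B" using T(2) by auto
  then have "\<exists>!a. a \<in> A \<and> a \<notin> nbhd G b \<and> a \<notin> nbhd G b'"
    using assms(1) b(2) by (simp add: meets_once_def)
  then obtain a where a: "a \<in> A" "a \<notin> nbhd G b" "a \<notin> nbhd G b'" by auto
  obtain c where c: "c \<in> nbhd G a" "c \<in> S" using assms(3)[OF a(1)] by auto
  then have "c \<in> S \<inter> B" using nbhd_side(2)[OF a(1)] by auto
  then have "c = b \<or> c = b'" using T(1) b(1) by auto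
  then show False using c(1) a(2,3) nbhd_sym by auto
qed

text \<open>After \<open>b1\<close> and \<open>b2\<close> only one vertex of \<open>A\<close> is undominated, so there is work for at most one
  more vertex.\<close>

lemma meets_once_legal:
  assumes meets_once "legal G vs" "set vs \<subseteq> B"
  shows "length vs \<le> 3"
proof (rule ccontr)
  assume "\<not> ?thesis"
  then have "4 \<le> length vs" by simp
  then obtain b1 b2 b3 b4 ws where vs: "vs = b1 # b2 # b3 # b4 # ws"
    by (auto simp: Suc_le_length_iff numeral_eq_Suc)
  then have "legal G (((([] @ [b1]) @ [b2]) @ [b3]) @ [b4])"
    using legal_appendD[of "[b1, b2, b3, b4]" ws] assms(2) by simp
  then obtain a3 a4 where a: "a3 \<in> nbhd G b3" "a3 \<notin> nbhd G b1" "a3 \<notin> nbhd G b2"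
      "a4 \<in> nbhd G b4" "a4 \<notin> nbhd G b1" "a4 \<notin> nbhd G b2" "a4 \<notin> nbhd G b3"
    unfolding legal_snoc by auto
  have "b1 \<in> B" "b2 \<in> B" "b3 \<in> B" "b4 \<in> B" "b1 \<noteq> b2" using vs assms by (auto simp: legal_def)
  moreover from this have "a3 \<in> A" "a4 \<in> A" using a nbhd_side by blast+
  ultimately have "a3 = a4" using assms(1) a unfolding meets_once_def by blast
  then show False using a by simp
qed

lemma numbers_eq_6_if_meets_once:
  assumes "meets_once" "bipartite_graph.meets_once G B A" "2 \<le> card A" "2 \<le> card B"
  shows "total_domination_number G = 6 \<and> grundy_total_domination_number G = 6"
  unfolding both_numbers_eq_iff
proof (intro conjI allI impI)
  interpret swap: bipartite_graph G B A by (rule swap)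
  fix S assume S: "total_dominating_set G S"
  have "3 \<le> card (S \<inter> B)"
    using S parts by (intro meets_once_dominators assms) (auto simp: total_dominating_set_def)
  moreover have "3 \<le> card (S \<inter> A)"
    using S parts by (intro swap.meets_once_dominators assms) (auto simp: total_dominating_set_def)
  moreover have "card S = card (S \<inter> A) + card (S \<inter> B)"
  proof -
    have "S = (S \<inter> A) \<union> (S \<inter> B)" using S parts by (auto simp: total_dominating_set_def)
    then show ?thesis using parts finite_sides card_Un_disjoint[of "S \<inter> A" "S \<inter> B"] by auto
  qed
  ultimately show "6 \<le> card S" by simp
next
  interpret swap: bipartite_graph G B A by (rule swap)
  fix vs assume vs: "legal G vs"
  have "length (filter (\<lambda>v. v \<in> B) vs) \<le> 3"
    using vs by (intro meets_once_legal assms legal_filter) auto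
  moreover have "length (filter (\<lambda>v. v \<in> A) vs) \<le> 3"
    using vs by (intro swap.meets_once_legal assms legal_filter) auto
  moreover have "filter (\<lambda>v. v \<in> A) vs = filter (\<lambda>v. v \<notin> B) vs"
    using vs parts by (intro filter_cong) (auto simp: legal_def)
  ultimately show "length vs \<le> 6"
    using sum_length_filter_compl[of "\<lambda>v. v \<in> B" vs] by simp
qed

text \<open>Equal neighbourhoods would give two vertices at least two common non-neighbours.\<close>

lemma meets_once_distinct_nbhds:
  assumes meets_once "regular d G" "d + 2 \<le> card A" "b \<in> B" "b' \<in> B" "nbhd G b = nbhd G b'"
  shows "b = b'"
proof (rule ccontr)
  assume "b \<noteq> b'"
  then have "\<exists>!a. a \<in> A \<and> a \<notin> nbhd G b \<and> a \<notin> nbhd G b'"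
    using assms(1,4,5) by (simp add: meets_once_def)
  then obtain a where "A - nbhd G b \<subseteq> {a}" using assms(6) by auto
  then have "card (A - nbhd G b) \<le> 1" using card_mono[of "{a}"] by simp
  moreover have "card (A - nbhd G b) = card A - d"
    using nbhd_side(1)[OF assms(4)] finite_nbhd assms(2,4) parts
    by (subst card_Diff_subset) (auto simp: regular_def)
  ultimately show False using assms(3) by simp
qed

lemma false_twin_free_if_meets_once:
  assumes meets_once "bipartite_graph.meets_once G B A" "regular d G"
    "d + 2 \<le> card A" "d + 2 \<le> card B"
  shows "false_twin_free G"
proof -
  interpret swap: bipartite_graph G B A by (rule swap)
  have "u = v" if uv: "u \<in> pverts G" "v \<in> pverts G" "nbhd G u = nbhd G v" for u v
  proof -
    consider "u \<in> A" "v \<in> A" | "u \<in> B" "v \<in> B" | "u \<in> A" "v \<in> B" | "u \<in> B" "v \<in> A"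
      using uv parts by blast
    then show ?thesis
    proof cases
      case 1
      then show ?thesis using swap.meets_once_distinct_nbhds assms uv by blast
    next
      case 2
      then show ?thesis using meets_once_distinct_nbhds assms uv by blast
    qed (use uv nbhd_nonempty[of u] nbhd_side[of u] nbhd_side[of v] parts(2) in blast)+
  qed
  then show ?thesis by (auto simp: false_twin_free_def false_twins_def)
qed

text \<open>Each side is incident with all edges.\<close>

lemma sides_equal_if_regular:
  assumes "regular d G" "0 < d"
  shows "card A = card B"
proof -
  have "(\<Sum>a\<in>A. card {b \<in> B. b \<in> nbhd G a}) = (\<Sum>b\<in>B. d)"
  proof (rule sum_multicount_gen[OF finite_sides], rule ballI)
    fix b assume b: "b \<in> B"
    have "{a \<in> A. b \<in> nbhd G a} = nbhd G b" using nbhd_side b nbhd_sym by blast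
    then show "card {a \<in> A. b \<in> nbhd G a} = d"
      using b assms(1) parts by (auto simp: regular_def)
  qed
  moreover have "card {b \<in> B. b \<in> nbhd G a} = d" if "a \<in> A" for a
  proof -
    have "{b \<in> B. b \<in> nbhd G a} = nbhd G a" using nbhd_side that by blast
    then show ?thesis using that assms(1) parts by (auto simp: regular_def)
  qed
  ultimately show ?thesis using assms(2) by simp
qed

end

section \<open>Non-neighbourhoods as lines\<close>

context bipartite_graph
begin

definition line :: "'a \<Rightarrow> 'a set" where
  "line b = A - nbhd G b"

text \<open>The condition for \<open>A\<close> says that two points have a unique joining line. Each point \<open>x\<close> lies on
  the \<open>k\<close> lines that belong to its non-neighbours, so \<open>card_pencil\<close> determines \<open>n\<close>.\<close>

lemma weak_plane_if_meets_once:
  assumes regular: "regular (n - k) G" and n: "card A = n" "card B = n" "k \<le> n" "2 \<le> n"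
    and "meets_once" "bipartite_graph.meets_once G B A"
    and twin_free: "false_twin_free G"
  shows "n = k\<^sup>2 - k + 1 \<and> weak_plane A (line ` B) (k - 1)"
proof -
  interpret swap: bipartite_graph G B A by (rule swap)
  have card_line: "card (line b) = k" if b: "b \<in> B" for b
  proof -
    have "card (line b) = card A - card (nbhd G b)"
      using nbhd_side(1)[OF b] finite_nbhd by (simp add: line_def card_Diff_subset)
    also have "card (nbhd G b) = n - k" using regular b parts by (auto simp: regular_def)
    finally show ?thesis using n by simp
  qed
  have inj: "inj_on line B"
  proof (rule inj_onI)
    fix b b' assume b: "b \<in> B" "b' \<in> B" "line b = line b'"
    then have "nbhd G b = nbhd G b'" using nbhd_side(1)[of b] nbhd_side(1)[of b'] unfolding line_def by auto
    moreover have "b \<in> pverts G" "b' \<in> pverts G" using b parts by auto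
    ultimately show "b = b'" using twin_free unfolding false_twin_free_def false_twins_def by blast
  qed
  have join: "\<exists>!b. b \<in> B \<and> x \<in> line b \<and> y \<in> line b" if xy: "x \<in> A" "y \<in> A" "x \<noteq> y" for x y
  proof -
    have "\<exists>!b. b \<in> B \<and> b \<notin> nbhd G x \<and> b \<notin> nbhd G y"
      using assms(7) xy by (simp add: swap.meets_once_def)
    moreover have "b \<in> B \<and> b \<notin> nbhd G x \<and> b \<notin> nbhd G y \<longleftrightarrow> b \<in> B \<and> x \<in> line b \<and> y \<in> line b" for b
      using xy nbhd_sym by (auto simp: line_def)
    ultimately show ?thesis by simp
  qed
  have "\<not> card A \<le> 1" using n by simp
  then obtain x y where xy: "x \<in> A" "y \<in> A" "x \<noteq> y"
    using card_le_Suc0_iff_eq[OF finite_sides(1)] by auto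
  have k: "2 \<le> k"
  proof -
    obtain b where b: "b \<in> B" "x \<in> line b" "y \<in> line b" using join[OF xy] by auto
    have "card {x, y} \<le> card (line b)"
      using b finite_sides by (intro card_mono) (auto simp: line_def)
    then show ?thesis using xy card_line[OF b(1)] by simp
  qed
  have ls: "linear_space A (line ` B) k"
  proof
    show "\<exists>!L. L \<in> line ` B \<and> x \<in> L \<and> y \<in> L" if "x \<in> A" "y \<in> A" "x \<noteq> y" for x y
      using join[OF that] by auto
  qed (use finite_sides k card_line in \<open>auto simp: line_def\<close>)
  then interpret linear_space A "line ` B" k .
  have "card (pencil x) = k"
  proof -
    have "pencil x = line ` (B - nbhd G x)"
      unfolding pencil_def using xy(1) nbhd_sym by (auto simp: line_def)
    then have "card (pencil x) = card (B - nbhd G x)"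
      using inj by (simp add: card_image inj_on_diff)
    also have "\<dots> = card B - card (nbhd G x)"
      using nbhd_side(2)[OF xy(1)] finite_nbhd by (simp add: card_Diff_subset)
    also have "card (nbhd G x) = n - k" using regular xy(1) parts by (auto simp: regular_def)
    finally show ?thesis using n by simp
  qed
  then have count: "n - 1 = k * (k - 1)" using card_pencil[OF xy(1)] n by simp
  obtain q where q: "k = q + 1" using k that[of "k - 1"] by simp
  have "n = q\<^sup>2 + q + 1" using count n q by (simp add: power2_eq_square algebra_simps)
  moreover from this have "n = k\<^sup>2 - k + 1" using q by (simp add: power2_eq_square algebra_simps)
  ultimately show ?thesis using ls n q by (simp add: weak_plane_def weak_plane_axioms_def)
qed

end

definition six_graph_exists :: "nat \<Rightarrow> nat \<Rightarrow> bool" where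
  "six_graph_exists n k \<longleftrightarrow>
     (\<exists>G :: nat pair_pre_digraph.
        pair_graph G \<and> card (pverts G) = 2 * n \<and> no_isolated_vertices G \<and>
        k \<le> n \<and> regular (n - k) G \<and> bipartite G \<and> false_twin_free G \<and>
        total_domination_number G = 6 \<and> grundy_total_domination_number G = 6)"

lemma weak_plane_if_graph:
  assumes "six_graph_exists n k"
  shows "n = k\<^sup>2 - k + 1 \<and> (\<exists>(X :: nat set) \<B>. weak_plane X \<B> (k - 1))"
proof -
  obtain G :: "nat pair_pre_digraph" where G: "pair_graph G" "card (pverts G) = 2 * n"
    "no_isolated_vertices G" "k \<le> n" "regular (n - k) G" "bipartite G" "false_twin_free G"
    "total_domination_number G = 6" "grundy_total_domination_number G = 6"
    using assms by (auto simp: six_graph_exists_def)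
  interpret isolate_free_graph G
    using G by (simp add: isolate_free_graph_def isolate_free_graph_axioms_def)
  obtain A B where AB: "A \<union> B = pverts G" "A \<inter> B = {}"
    "\<forall>(u, v)\<in>parcs G. u \<in> A \<and> v \<in> B \<or> u \<in> B \<and> v \<in> A"
    using G(6) unfolding bipartite_def by blast
  interpret bipartite_graph G A B
    using AB by unfold_locales auto
  interpret swap: bipartite_graph G B A by (rule swap)
  have bounds: "\<forall>S. total_dominating_set G S \<longrightarrow> 6 \<le> card S"
    "\<forall>vs. legal G vs \<longrightarrow> length vs \<le> 6"
    using both_numbers_eq_iff[of 6] G(8,9) by auto
  have "total_dominating_set G (pverts G)"
    using nbhd_nonempty nbhd_verts unfolding total_dominating_set_def by blast
  then have n: "3 \<le> n" using bounds(1) G(2) by fastforce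
  have incomparable: "\<not> nbhd G u \<subseteq> nbhd G v"
    if uv: "u \<in> pverts G" "v \<in> pverts G" "u \<noteq> v" for u v
  proof
    assume "nbhd G u \<subseteq> nbhd G v"
    moreover have "card (nbhd G u) = card (nbhd G v)" using G(5) uv by (simp add: regular_def)
    ultimately have "nbhd G u = nbhd G v" using card_subset_eq[OF finite_nbhd] by blast
    then show False using G(7) uv by (auto simp: false_twin_free_def false_twins_def)
  qed
  have "card A + card B = 2 * n"
    using card_Un_disjoint[OF finite_sides AB(2)] AB(1) G(2) by simp
  moreover have "0 < n - k"
  proof -
    have "pverts G \<noteq> {}" using n G(2) by auto
    then obtain v where v: "v \<in> pverts G" by blast
    then have "0 < card (nbhd G v)" using nbhd_nonempty finite_nbhd by (simp add: card_gt_0_iff)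
    then show ?thesis using G(5) v by (simp add: regular_def)
  qed
  ultimately have "card A = n" "card B = n" using sides_equal_if_regular[OF G(5)] by auto
  then have "n = k\<^sup>2 - k + 1 \<and> weak_plane A (line ` B) (k - 1)"
    using meets_once_if_numbers_eq_6[OF bounds incomparable]
      swap.meets_once_if_numbers_eq_6[OF bounds incomparable] n
    by (intro weak_plane_if_meets_once[OF G(5)] G) auto
  then show ?thesis by blast
qed

text \<open>The non-incidence graph of points and lines: \<open>i\<close> stands for the point \<open>e i\<close> and \<open>n + j\<close> for the
  line \<open>l j\<close>. Common non-neighbours of two lines are their common points, and those of two points are
  the lines joining them.\<close>

lemma graph_if_weak_plane:
  fixes X :: "'a set"
  assumes "weak_plane X \<B> q"
  shows "six_graph_exists (q\<^sup>2 + q + 1) (q + 1)"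
proof -
  interpret weak_plane X \<B> q by fact
  define n where "n = q\<^sup>2 + q + 1"
  obtain e where e: "bij_betw e {..<n} X"
    using ex_bij_betw_nat_finite[OF finite_points] card_points
    by (auto simp: atLeast0LessThan n_def)
  obtain l where l: "bij_betw l {..<n} \<B>"
    using ex_bij_betw_nat_finite[OF finite_blocks] card_blocks
    by (auto simp: atLeast0LessThan n_def)
  have eX: "e i \<in> X" if "i < n" for i using bij_betw_apply[OF e] that by simp
  have lB: "l j \<in> \<B>" if "j < n" for j using bij_betw_apply[OF l] that by simp
  have e_inj: "i = i'" if "e i = e i'" "i < n" "i' < n" for i i'
    using inj_onD[OF bij_betw_imp_inj_on[OF e] that(1)] that by simp
  have l_inj: "j = j'" if "l j = l j'" "j < n" "j' < n" for j j'
    using inj_onD[OF bij_betw_imp_inj_on[OF l] that(1)] that by simp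
  have e_surj: "\<exists>i<n. e i = x" if "x \<in> X" for x
    using e that by (metis bij_betw_imp_surj_on imageE lessThan_iff)
  have l_surj: "\<exists>j<n. l j = B" if "B \<in> \<B>" for B
    using l that by (metis bij_betw_imp_surj_on imageE lessThan_iff)
  define E where "E = {(i, n + j) | i j. i < n \<and> j < n \<and> e i \<notin> l j}"
  define G :: "nat pair_pre_digraph" where "G = \<lparr> pverts = {..<2 * n}, parcs = E \<union> E\<inverse> \<rparr>"
  have nbhd_point: "nbhd G i = {n + j | j. j < n \<and> e i \<notin> l j}" if "i < n" for i
    using that by (auto simp: G_def E_def nbhd_def)
  have nbhd_line: "nbhd G (n + j) = {i. i < n \<and> e i \<notin> l j}" if "j < n" for j
    using that by (auto simp: G_def E_def nbhd_def)
  have card_point: "card (nbhd G i) = n - (q + 1)" if i: "i < n" for i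
  proof -
    have "bij_betw (\<lambda>v. l (v - n)) (nbhd G i) (\<B> - pencil (e i))"
      unfolding nbhd_point[OF i]
    proof (intro bij_betw_imageI inj_onI equalityI subsetI)
      fix B assume "B \<in> \<B> - pencil (e i)"
      then have "B \<in> \<B>" "e i \<notin> B" by (auto simp: pencil_def)
      moreover from this obtain j where "j < n" "l j = B" using l_surj by blast
      ultimately have "n + j \<in> {n + j | j. j < n \<and> e i \<notin> l j}" "B = l (n + j - n)" by auto
      then show "B \<in> (\<lambda>v. l (v - n)) ` {n + j | j. j < n \<and> e i \<notin> l j}" by blast
    qed (use l_inj lB in \<open>auto simp: pencil_def\<close>)
    then have "card (nbhd G i) = card (\<B> - pencil (e i))" by (rule bij_betw_same_card)
    also have "\<dots> = n - (q + 1)"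
      using card_pencil_plane[OF eX[OF i]] card_blocks finite_blocks
      by (subst card_Diff_subset) (auto simp: pencil_def n_def)
    finally show ?thesis .
  qed
  have card_line: "card (nbhd G (n + j)) = n - (q + 1)" if j: "j < n" for j
  proof -
    have "bij_betw e (nbhd G (n + j)) (X - l j)"
      unfolding nbhd_line[OF j]
    proof (intro bij_betw_imageI inj_onI equalityI subsetI)
      fix x assume "x \<in> X - l j"
      then show "x \<in> e ` {i. i < n \<and> e i \<notin> l j}" using e_surj[of x] by auto
    qed (use e_inj eX in auto)
    then have "card (nbhd G (n + j)) = card (X - l j)" by (rule bij_betw_same_card)
    also have "\<dots> = n - (q + 1)"
      using block_subset[OF lB[OF j]] card_block[OF lB[OF j]] finite_block[OF lB[OF j]]
      by (simp add: card_Diff_subset card_points n_def)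
    finally show ?thesis .
  qed
  have vertex: "v < n \<or> (\<exists>j<n. v = n + j)" if "v \<in> pverts G" for v
    using that by (auto simp: G_def intro: exI[of _ "v - n"])
  have regular: "regular (n - (q + 1)) G"
    unfolding regular_def using vertex card_point card_line by auto
  have degree_pos: "0 < n - (q + 1)" using order_pos by (simp add: n_def)
  have pg: "pair_graph G"
  proof
    show "finite (parcs G)"
      by (rule finite_subset[of _ "{..<2 * n} \<times> {..<2 * n}"]) (auto simp: G_def E_def)
    show "symmetric (with_proj G)"
      by (auto simp: symmetric_def G_def sym_def)
  qed (auto simp: G_def E_def)
  have no_iso: "no_isolated_vertices G"
    unfolding no_isolated_vertices_def
    using regular degree_pos by (force simp: regular_def)
  interpret bipartite_graph G "{..<n}" "{n..<2 * n}"
    unfolding bipartite_graph_def isolate_free_graph_def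
      isolate_free_graph_axioms_def bipartite_graph_axioms_def
    using pg no_iso by (auto simp: G_def E_def)
  interpret swap: bipartite_graph G "{n..<2 * n}" "{..<n}" by (rule swap)
  have meets: meets_once
    unfolding meets_once_def
  proof (intro ballI impI)
    fix b b' assume "b \<in> {n..<2 * n}" "b' \<in> {n..<2 * n}" "b \<noteq> b'"
    then obtain j j' where j: "b = n + j" "b' = n + j'" "j < n" "j' < n" "j \<noteq> j'"
      by (auto simp: nat_le_iff_add)
    then have ne: "l j \<noteq> l j'" using l_inj by blast
    obtain x where x: "x \<in> l j" "x \<in> l j'" using blocks_meet[OF lB lB] j by blast
    then have "x \<in> X" using block_subset[OF lB] j by blast
    then obtain i where i: "i < n" "e i = x" using e_surj by blast
    show "\<exists>!a. a \<in> {..<n} \<and> a \<notin> nbhd G b \<and> a \<notin> nbhd G b'"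
    proof (rule ex1I[of _ i])
      show "i \<in> {..<n} \<and> i \<notin> nbhd G b \<and> i \<notin> nbhd G b'"
        using i x j by (simp add: nbhd_line)
      fix a assume "a \<in> {..<n} \<and> a \<notin> nbhd G b \<and> a \<notin> nbhd G b'"
      then have a: "a < n" "e a \<in> l j" "e a \<in> l j'" using j by (auto simp: nbhd_line)
      then have "e a = e i"
        using common_point_unique[OF lB lB ne] j x i by blast
      then show "a = i" using e_inj a i by blast
    qed
  qed
  have swap_meets: swap.meets_once
    unfolding swap.meets_once_def
  proof (intro ballI impI)
    fix i i' assume "i \<in> {..<n}" "i' \<in> {..<n}" "i \<noteq> i'"
    then have i: "i < n" "i' < n" "e i \<noteq> e i'" using e_inj by auto
    obtain j where j: "j < n" "l j = join (e i) (e i')" using l_surj join[OF eX eX] i by blast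
    show "\<exists>!b. b \<in> {n..<2 * n} \<and> b \<notin> nbhd G i \<and> b \<notin> nbhd G i'"
    proof (rule ex1I[of _ "n + j"])
      show "n + j \<in> {n..<2 * n} \<and> n + j \<notin> nbhd G i \<and> n + j \<notin> nbhd G i'"
        using i j join[OF eX eX i(3)] by (auto simp: nbhd_point)
      fix b assume b: "b \<in> {n..<2 * n} \<and> b \<notin> nbhd G i \<and> b \<notin> nbhd G i'"
      then obtain j' where j': "b = n + j'" "j' < n" by (auto simp: nat_le_iff_add)
      then have "join (e i) (e i') = l j'"
        using b i by (intro join_eqI[OF lB]) (auto simp: nbhd_point)
      then show "b = n + j" using j j' l_inj by simp
    qed
  qed
  have numbers: "total_domination_number G = 6 \<and> grundy_total_domination_number G = 6"
    using order_pos by (intro numbers_eq_6_if_meets_once meets swap_meets) (auto simp: n_def)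
  have "false_twin_free G"
    using order_pos
    by (intro false_twin_free_if_meets_once[OF meets swap_meets regular]) (auto simp: n_def)
  moreover have "bipartite G"
    unfolding bipartite_def
    by (intro exI[of _ "{..<n}"] exI[of _ "{n..<2 * n}"] conjI parts) (use crossing in auto)
  ultimately show ?thesis
    using pg no_iso regular numbers
    unfolding six_graph_exists_def n_def[symmetric]
    by (intro exI[of _ G] conjI) (auto simp: G_def n_def)
qed

lemma graph_iff_weak_plane:
  "six_graph_exists n k \<longleftrightarrow> n = k\<^sup>2 - k + 1 \<and> (\<exists>(X :: nat set) \<B>. weak_plane X \<B> (k - 1))"
proof
  assume "n = k\<^sup>2 - k + 1 \<and> (\<exists>(X :: nat set) \<B>. weak_plane X \<B> (k - 1))"
  then obtain X :: "nat set" and \<B> where n: "n = k\<^sup>2 - k + 1" and plane: "weak_plane X \<B> (k - 1)"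
    by blast
  have k: "2 \<le> k" using weak_plane.order_pos[OF plane] by simp
  have "(k - 1)\<^sup>2 + (k - 1) + 1 = k\<^sup>2 - k + 1"
    using k by (cases k) (simp_all add: power2_eq_square)
  then show "six_graph_exists n k" using graph_if_weak_plane[OF plane] n k by simp
qed (rule weak_plane_if_graph)

theorem theorem4p7:
  fixes n k :: nat
  shows "let graph_exists =
      (\<exists>G :: nat pair_pre_digraph.
         pair_graph G \<and> card (pverts G) = 2 * n \<and> no_isolated_vertices G \<and>
         k \<le> n \<and> regular (n - k) G \<and> bipartite G \<and> false_twin_free G \<and>
         total_domination_number G = 6 \<and> grundy_total_domination_number G = 6)
    in
      (k \<noteq> 2 \<longrightarrow>
         (graph_exists \<longleftrightarrow> n = k^2 - k + 1 \<and> projective_plane_exists (k - 1)) \<and>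
         (projective_plane_exists (k - 1) \<longleftrightarrow> affine_plane_exists (k - 1)) \<and>
         (projective_plane_exists (k - 1) \<longleftrightarrow> mols_exist (k - 2) (k - 1)) \<and>
         (projective_plane_exists (k - 1) \<longleftrightarrow> orthogonal_array_exists k (k - 1))) \<and>
      (graph_exists \<longleftrightarrow> n = k^2 - k + 1 \<and> mols_exist (k - 2) (k - 1)) \<and>
      (graph_exists \<longleftrightarrow> n = k^2 - k + 1 \<and> orthogonal_array_exists k (k - 1))"
proof -
  define plane where "plane \<longleftrightarrow> (\<exists>(X :: nat set) \<B>. weak_plane X \<B> (k - 1))"
  have graph: "six_graph_exists n k \<longleftrightarrow> n = k^2 - k + 1 \<and> plane"
    unfolding plane_def by (rule graph_iff_weak_plane)
  have OA: "orthogonal_array_exists k (k - 1) \<longleftrightarrow> plane"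
  proof (cases "k = 0")
    \<comment> \<open>For \<open>k = 0\<close> truncation gives \<open>k - 1 + 1 \<noteq> k\<close>.\<close>
    case True
    then show ?thesis
      by (auto simp: plane_def orthogonal_array_exists_def orthogonal_array_def
          dest: weak_plane.order_pos)
  next
    case False
    then show ?thesis using weak_plane_iff_orthogonal_array[of "k - 1"] by (simp add: plane_def)
  qed
  have MOLS: "mols_exist (k - 2) (k - 1) \<longleftrightarrow> plane"
  proof (cases "k \<le> 1")
    case True
    then have "k - 1 = 0" by simp
    then show ?thesis
      by (auto simp: plane_def mols_exist_def mols_def dest: weak_plane.order_pos)
  next
    case False
    then have "k - 2 + 2 = k" by simp
    then show ?thesis using mols_iff_orthogonal_array[of "k - 2" "k - 1"] OA by simp
  qed
  have PP: "projective_plane_exists (k - 1) \<longleftrightarrow> plane" if "k \<noteq> 2"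
    unfolding plane_def using that by (intro projective_plane_iff_weak_plane) simp
  have AP: "affine_plane_exists (k - 1) \<longleftrightarrow> plane" if "k \<noteq> 2"
    unfolding plane_def weak_plane_iff_orthogonal_array
    using that by (intro affine_plane_iff_orthogonal_array) simp
  show ?thesis
    unfolding Let_def six_graph_exists_def[symmetric] using graph OA MOLS PP AP by simp
qed

end
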